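(* Let $k\ge 0$ and $r\in\{0,1,2,3,4\}$ be integers with $n=5k+r\ge 1$. If $n\notin\{1,2,3,7\}$, then $$\pi_{\mathrm{opt}}(S_{5,5k+r})=\pi_{\mathrm{opt}}(S'_{5,5k+r})=4k+r.$$ Moreover $\pi_{\mathrm{opt}}(S_{5,3})=\pi_{\mathrm{opt}}(S'_{5,3})=4$ and $\pi_{\mathrm{opt}}(S'_{5,7})=7$.
   Context: A pebbling distribution $P$ on a finite simple graph $G$ is a function $P:V(G)\to\mathbb{Z}_{\ge 0}$; its size is $|P|=\sum_{v}P(v)$. A pebbling move from a vertex $u$ having at least two pebbles to a neighbor $v$ of $u$ removes two pebbles from $u$ and adds one pebble to $v$. A vertex $v$ is reachable under $P$ if some (possibly empty) sequence of pebbling moves starting from $P$ yields a distribution with at least one pebble on $v$. $P$ is solvable if every vertex of $G$ is reachable under $P$. The optimal pebbling number $\pi_{\mathrm{opt}}(G)$ is the minimum size of a solvable distribution on $G$. Let $SG$ be the infinite square grid: vertex set $\mathbb{Z}^2$, with $(i,j)$ and $(i',j')$ adjacent iff $|i-i'|+|j-j'|=1$. For $k\in\mathbb{Z}$ let $D^+_k=\{(i,j): i-j=k\}$ (positive diagonal) and $D^-_k=\{(i,j): i+j=k\}$ (negative diagonal). For integers $n\ge 1$ and odd $m$, $S'_{m,n}$ is the subgraph of $SG$ induced by $\left(\bigcup_{j=1}^m D^-_j\right)\cap\left(\bigcup_{i=1}^n D^+_i\right)$, and $S_{m,n}$ is the subgraph induced by $\left(\bigcup_{j=1}^m D^-_j\right)\cap\left(\bigcup_{i=0}^{n-1}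 D^+_i\right)$. *)

theory Defs
  imports Main
begin

text \<open>
  A finite simple graph is a record satisfying the predicate \<open>simple_graph\<close>.  The infinite
  square grid is a record of the same kind, with infinite vertex set.
\<close>

record 'a graph =
  verts :: "'a set"
  adj :: "'a \<Rightarrow> 'a \<Rightarrow> bool"

definition simple_graph :: "'a graph \<Rightarrow> bool" where
  "simple_graph G \<longleftrightarrow>
     finite (verts G) \<and>
     (\<forall>u v. adj G u v \<longrightarrow> u \<in> verts G \<and> v \<in> verts G \<and> u \<noteq> v \<and> adj G v u)"

definition induced_subgraph :: "'a graph \<Rightarrow> 'a set \<Rightarrow> 'a graph" where
  "induced_subgraph G W =
     \<lparr>verts = verts G \<inter> W, adj = (\<lambda>u v. u \<in> W \<and> v \<in> W \<and> adj G u v)\<rparr>"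

text \<open>
  A function from the vertex set to the natural numbers is represented by a total function
  that vanishes off the vertex set.
\<close>

definition pebbling_distribution :: "'a graph \<Rightarrow> ('a \<Rightarrow> nat) \<Rightarrow> bool" where
  "pebbling_distribution G P \<longleftrightarrow> (\<forall>v. v \<notin> verts G \<longrightarrow> P v = 0)"

definition distribution_size :: "'a graph \<Rightarrow> ('a \<Rightarrow> nat) \<Rightarrow> nat" where
  "distribution_size G P = (\<Sum>v\<in>verts G. P v)"

definition pebbling_move :: "'a graph \<Rightarrow> ('a \<Rightarrow> nat) \<Rightarrow> ('a \<Rightarrow> nat) \<Rightarrow> bool" where
  "pebbling_move G P Q \<longleftrightarrow>
     (\<exists>u v. adj G u v \<and> 2 \<le> P u \<and> Q = P(u := P u - 2, v := P v + 1))"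

definition reachable :: "'a graph \<Rightarrow> ('a \<Rightarrow> nat) \<Rightarrow> 'a \<Rightarrow> bool" where
  "reachable G P v \<longleftrightarrow> (\<exists>Q. (pebbling_move G)\<^sup>*\<^sup>* P Q \<and> 1 \<le> Q v)"

definition solvable :: "'a graph \<Rightarrow> ('a \<Rightarrow> nat) \<Rightarrow> bool" where
  "solvable G P \<longleftrightarrow> (\<forall>v\<in>verts G. reachable G P v)"

text \<open>For a finite graph the minimum is attained; see \<open>optimal_pebbling_number_attained\<close>.\<close>

definition optimal_pebbling_number :: "'a graph \<Rightarrow> nat" where
  "optimal_pebbling_number G =
     (LEAST s. \<exists>P. pebbling_distribution G P \<and> solvable G P \<and> distribution_size G P = s)"

definition square_grid :: "(int \<times> int) graph" where
  "square_grid =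
     \<lparr>verts = UNIV, adj = (\<lambda>(i, j) (i', j'). \<bar>i - i'\<bar> + \<bar>j - j'\<bar> = 1)\<rparr>"

definition pos_diagonal :: "int \<Rightarrow> (int \<times> int) set" where
  "pos_diagonal k = {(i, j). i - j = k}"

definition neg_diagonal :: "int \<Rightarrow> (int \<times> int) set" where
  "neg_diagonal k = {(i, j). i + j = k}"

text \<open>
  The parameter \<open>m\<close> (number of negative diagonals) is meant to be odd and \<open>n\<close> (number of
  positive diagonals) to be at least 1.  \<open>S_graph'\<close> starts at the positive diagonal with
  index 1, \<open>S_graph\<close> at the one with index 0.
\<close>

definition S_graph' :: "nat \<Rightarrow> nat \<Rightarrow> (int \<times> int) graph" where
  "S_graph' m n = induced_subgraph square_grid
     ((\<Union>j\<in>{1..int m}. neg_diagonal j) \<inter> (\<Union>i\<in>{1..int n}. pos_diagonal i))"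

definition S_graph :: "nat \<Rightarrow> nat \<Rightarrow> (int \<times> int) graph" where
  "S_graph m n = induced_subgraph square_grid
     ((\<Union>j\<in>{1..int m}. neg_diagonal j) \<inter> (\<Union>i\<in>{0..int n - 1}. pos_diagonal i))"

lemma optimal_pebbling_number_attained:
  "\<exists>P. pebbling_distribution G P \<and> solvable G P \<and>
       distribution_size G P = optimal_pebbling_number G"
proof -
  let ?P = "\<lambda>v. if v \<in> verts G then 1 else 0 :: nat"
  have "pebbling_distribution G ?P"
    by (simp add: pebbling_distribution_def)
  moreover have "solvable G ?P"
    unfolding solvable_def reachable_def by (intro ballI exI[of _ ?P]) simp
  ultimately have "\<exists>s P. pebbling_distribution G P \<and> solvable G P \<and> distribution_size G P = s"
    by blast
  then show ?thesis
    unfolding optimal_pebbling_number_def by (rule LeastI_ex)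
qed

lemma finite_diagonal_box:
  "finite ((\<Union>j\<in>{a..b}. neg_diagonal j) \<inter> (\<Union>i\<in>{c..d}. pos_diagonal i))"
proof (rule finite_subset)
  let ?f = "\<lambda>(s, t). ((s + t) div 2, (s - t) div 2) :: int \<times> int"
  show "(\<Union>j\<in>{a..b}. neg_diagonal j) \<inter> (\<Union>i\<in>{c..d}. pos_diagonal i) \<subseteq> ?f ` ({a..b} \<times> {c..d})"
  proof
    fix x assume x: "x \<in> (\<Union>j\<in>{a..b}. neg_diagonal j) \<inter> (\<Union>i\<in>{c..d}. pos_diagonal i)"
    obtain i j where "x = (i, j)" by (cases x)
    with x have "x = ?f (i + j, i - j)" "(i + j, i - j) \<in> {a..b} \<times> {c..d}"
      by (auto simp: neg_diagonal_def pos_diagonal_def)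
    then show "x \<in> ?f ` ({a..b} \<times> {c..d})" by (rule image_eqI)
  qed
qed simp

lemma simple_graph_S_graph': "simple_graph (S_graph' m n)"
  unfolding simple_graph_def S_graph'_def induced_subgraph_def square_grid_def
  using finite_diagonal_box by (auto simp: abs_minus_commute)

lemma simple_graph_S_graph: "simple_graph (S_graph m n)"
  unfolding simple_graph_def S_graph_def induced_subgraph_def square_grid_def
  using finite_diagonal_box by (auto simp: abs_minus_commute)

end

theory Submission
  imports Defs
begin

text \<open>
  The graph is a strip of columns: the column \<open>t\<close> consists of the vertices \<open>(i, j)\<close> with
  \<open>i - j = t\<close> and \<open>1 \<le> i + j \<le> 5\<close>. It has two vertices for even \<open>t\<close> and three for odd \<open>t\<close>,
  and edges join consecutive columns only. Since \<open>4 * k + r\<close> is \<open>4 * n / 5\<close> rounded up for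
  \<open>n = 5 * k + r\<close>, the claim is that four pebbles per five columns are the best possible price.

  Four pebbles do serve five columns: on the middle vertex of an odd column a stack of four
  reaches everything at distance two, and in an even column two stacks of two meet on both
  neighbouring columns. Such blocks are placed side by side, together with one block for the
  remainder: four, six or eight columns, or two blocks of six
  (\<open>solvable_with_4k_plus_r\<close>).

  For the lower bound only the numbers \<open>c t\<close> of pebbles in the columns are remembered. The part of
  the strip up to column \<open>t\<close> can bring at most \<open>L t = c t + L (t - 1) div 2\<close> pebbles together in
  column \<open>t\<close>, and symmetrically \<open>R t\<close> from the right. These numbers bound what can ever be in a
  column (\<open>capacity_move\<close>), but on their own they describe a path, where two pebbles per three
  columns suffice. What makes the strip more expensive is that all vertices of a column have to be
  reached. Three consequences of this are enough: a column holds at least two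
  pebbles if the supplies of both neighbours are at most one; it holds at least three if these
  supplies are zero; and two neighbouring columns with two pebbles and one pebble need a nonzero
  supply from outside (\<open>exposed_column_ge_2\<close>, \<open>isolated_column_ge_3\<close>,
  \<open>isolated_pair\<close>). Each of them says that few pebbles are locked into a window of columns, and
  mostly follows because a weight that halves with the distance from a target is too small.

  Let now every pebble bring five units and every column cost four. A supply of \<open>n\<close> pebbles can be
  passed on through \<open>\<lfloor>log\<^sub>2 n\<rfloor>\<close> empty columns, so it is given the credit of four times that number,
  which is what those columns cost. With this potential each column pays for itself,
  except one with two pebbles for which the larger of the supplies from its neighbours is one. It is two units short, and
  the columns on a side with supply one can afford to make up for it (\<open>column_balance\<close>). Summing
  over the columns gives
  \<open>4 * n \<le> 5 * size\<close>, with an additional term for the unused credit at the two ends of the strip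
  (\<open>charge_bound\<close>). That term also controls the ends of the two strips with exceptional values: it
  leaves so few distributions on three columns, and on seven columns of which the first and the last
  have three vertices, that these can be excluded directly (\<open>three_columns\<close>, \<open>seven_columns\<close>).
\<close>

section \<open>Gathering pebbles\<close>

text \<open>
  Reaching a vertex means gathering one pebble there. Larger numbers are needed to compose
  moves, and sums of distributions to let several stacks cooperate.
\<close>

definition gatherable :: "'a graph \<Rightarrow> ('a \<Rightarrow> nat) \<Rightarrow> 'a \<Rightarrow> nat \<Rightarrow> bool" where
  "gatherable G P v k \<longleftrightarrow> (\<exists>Q. (pebbling_move G)\<^sup>*\<^sup>* P Q \<and> k \<le> Q v)"

definition stack :: "'a \<Rightarrow> nat \<Rightarrow> 'a \<Rightarrow> nat" where
  "stack v k = (\<lambda>u. if u = v then k else 0)"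

lemma reachable_iff_gatherable: "reachable G P v \<longleftrightarrow> gatherable G P v 1"
  by (simp add: reachable_def gatherable_def)

lemma gatherable_stack: "gatherable G (stack v k) v k"
  unfolding gatherable_def stack_def by (rule exI[of _ "stack v k"]) (simp add: stack_def)

lemma moves_add:
  assumes "(pebbling_move G)\<^sup>*\<^sup>* P Q"
  shows "(pebbling_move G)\<^sup>*\<^sup>* (\<lambda>v. P v + R v) (\<lambda>v. Q v + R v)"
  using assms
proof (induction rule: rtranclp_induct)
  case (step Q Q')
  from step.hyps(2) obtain u v where uv: "adj G u v" "2 \<le> Q u" "Q' = Q(u := Q u - 2, v := Q v + 1)"
    by (auto simp: pebbling_move_def)
  have "pebbling_move G (\<lambda>w. Q w + R w) (\<lambda>w. Q' w + R w)"
    unfolding pebbling_move_def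
    by (rule exI[of _ u], rule exI[of _ v]) (use uv in \<open>auto simp: fun_eq_iff\<close>)
  then show ?case by (rule rtranclp.rtrancl_into_rtrancl[OF step.IH])
qed simp

lemma gatherable_add:
  assumes "gatherable G P v k" "gatherable G P' v k'"
  shows "gatherable G (\<lambda>u. P u + P' u) v (k + k')"
proof -
  obtain Q where Q: "(pebbling_move G)\<^sup>*\<^sup>* P Q" "k \<le> Q v"
    using assms(1) by (auto simp: gatherable_def)
  obtain Q' where Q': "(pebbling_move G)\<^sup>*\<^sup>* P' Q'" "k' \<le> Q' v"
    using assms(2) by (auto simp: gatherable_def)
  have "(pebbling_move G)\<^sup>*\<^sup>* (\<lambda>u. P u + P' u) (\<lambda>u. Q u + P' u)"
    by (rule moves_add[OF Q(1)])
  moreover have "(pebbling_move G)\<^sup>*\<^sup>* (\<lambda>u. Q u + P' u) (\<lambda>u. Q u + Q' u)"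
    using moves_add[OF Q'(1), of Q] by (simp add: add.commute)
  ultimately show ?thesis
    unfolding gatherable_def using Q(2) Q'(2) by (meson add_mono rtranclp_trans)
qed

lemma gatherable_mono:
  assumes "gatherable G P v k" "\<And>u. P u \<le> P' u"
  shows "gatherable G P' v k"
proof -
  have "gatherable G (\<lambda>u. P u + (P' u - P u)) v (k + 0)"
    by (rule gatherable_add[OF assms(1)]) (auto simp: gatherable_def)
  with assms(2) show ?thesis by simp
qed

lemma gatherable_step:
  assumes "gatherable G P u (2 * k)" "adj G u v" "u \<noteq> v"
  shows "gatherable G P v k"
proof -
  obtain Q where Q: "(pebbling_move G)\<^sup>*\<^sup>* P Q" "2 * k \<le> Q u"
    using assms(1) by (auto simp: gatherable_def)
  have "(pebbling_move G)\<^sup>*\<^sup>* P (Q(u := Q u - 2 * j, v := Q v + j))" if "j \<le> k" for j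
    using that
  proof (induction j)
    case 0
    then show ?case using Q(1) by simp
  next
    case (Suc j)
    let ?Q = "Q(u := Q u - 2 * j, v := Q v + j)"
    have "Q(u := Q u - 2 * Suc j, v := Q v + Suc j) = ?Q(u := ?Q u - 2, v := ?Q v + 1)"
      using assms(3) by (auto simp: fun_eq_iff)
    moreover have "2 \<le> ?Q u" using Suc.prems Q(2) assms(3) by simp
    ultimately have "pebbling_move G ?Q (Q(u := Q u - 2 * Suc j, v := Q v + Suc j))"
      unfolding pebbling_move_def using assms(2) by blast
    with Suc show ?case by (meson Suc_leD rtranclp.rtrancl_into_rtrancl)
  qed
  from this[of k] show ?thesis
    unfolding gatherable_def by (intro exI[of _ "Q(u := Q u - 2 * k, v := Q v + k)"]) simp
qed

lemma gatherable_subgraph: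
  assumes "gatherable G P v k" "\<And>u w. adj G u w \<Longrightarrow> adj H u w"
  shows "gatherable H P v k"
proof -
  have "pebbling_move G \<le> pebbling_move H"
    using assms(2) by (fastforce simp: pebbling_move_def)
  then have "(pebbling_move G)\<^sup>*\<^sup>* \<le> (pebbling_move H)\<^sup>*\<^sup>*" by (rule rtranclp_mono)
  then show ?thesis
    using assms(1) unfolding gatherable_def by blast
qed

section \<open>Strips and solvable distributions on them\<close>

definition cells :: "int \<Rightarrow> (int \<times> int) set" where
  "cells t = {v. fst v - snd v = t \<and> fst v + snd v \<in> {1..5}}"

definition strip :: "int \<Rightarrow> int \<Rightarrow> (int \<times> int) graph" where
  "strip lo hi = induced_subgraph square_grid (\<Union>t\<in>{lo..hi}. cells t)"

lemma S_graph_eq_strip: "S_graph 5 n = strip 0 (int n - 1)"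
  and S_graph'_eq_strip: "S_graph' 5 n = strip 1 (int n)"
proof -
  have "(\<Union>j\<in>{1..5}. neg_diagonal j) \<inter> (\<Union>i\<in>I. pos_diagonal i) = (\<Union>t\<in>I. cells t)" for I
    by (auto simp: cells_def neg_diagonal_def pos_diagonal_def)
  then show "S_graph 5 n = strip 0 (int n - 1)" "S_graph' 5 n = strip 1 (int n)"
    by (simp_all add: S_graph_def S_graph'_def strip_def)
qed

lemma verts_strip: "verts (strip lo hi) = (\<Union>t\<in>{lo..hi}. cells t)"
  by (simp add: strip_def induced_subgraph_def square_grid_def)

lemma mem_verts_strip:
  "v \<in> verts (strip lo hi) \<longleftrightarrow> fst v + snd v \<in> {1..5} \<and> fst v - snd v \<in> {lo..hi}"
  by (auto simp: verts_strip cells_def)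

lemma adj_strip:
  "adj (strip lo hi) u v \<longleftrightarrow> u \<in> verts (strip lo hi) \<and> v \<in> verts (strip lo hi) \<and>
     \<bar>fst u - fst v\<bar> + \<bar>snd u - snd v\<bar> = 1"
  by (cases u; cases v) (auto simp: verts_strip strip_def induced_subgraph_def square_grid_def)

definition grid_dist :: "int \<times> int \<Rightarrow> int \<times> int \<Rightarrow> int" where
  "grid_dist u v = \<bar>fst u - fst v\<bar> + \<bar>snd u - snd v\<bar>"

lemma cells_even: "cells (2 * m) = {(m + 1, 1 - m), (m + 2, 2 - m)}"
proof -
  have "(i, j) \<in> cells (2 * m) \<longleftrightarrow> (i, j) \<in> {(m + 1, 1 - m), (m + 2, 2 - m)}" for i j
    unfolding cells_def by simp presburger
  then show ?thesis by auto
qed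

lemma cells_odd: "cells (2 * m + 1) = {(m + 1, - m), (m + 2, 1 - m), (m + 3, 2 - m)}"
proof -
  have "(i, j) \<in> cells (2 * m + 1) \<longleftrightarrow> (i, j) \<in> {(m + 1, - m), (m + 2, 1 - m), (m + 3, 2 - m)}" for i j
    unfolding cells_def by simp presburger
  then show ?thesis by auto
qed

lemma finite_cells [simp]: "finite (cells t)"
  by (cases "even t") (auto elim!: evenE oddE simp: cells_even cells_odd)

lemma finite_verts_strip [simp]: "finite (verts (strip lo hi))"
  by (simp add: verts_strip)

definition solvable_with :: "int \<Rightarrow> int \<Rightarrow> nat \<Rightarrow> bool" where
  "solvable_with lo hi s \<longleftrightarrow> (\<exists>P. pebbling_distribution (strip lo hi) P \<and>
     solvable (strip lo hi) P \<and> distribution_size (strip lo hi) P = s)"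

lemma optimal_le: "solvable_with lo hi s \<Longrightarrow> optimal_pebbling_number (strip lo hi) \<le> s"
  unfolding solvable_with_def optimal_pebbling_number_def by (rule Least_le)

lemma solvable_withI:
  assumes "\<And>v. v \<notin> verts (strip lo hi) \<Longrightarrow> P v = 0"
    and "\<And>v. v \<in> verts (strip lo hi) \<Longrightarrow> gatherable (strip lo hi) P v 1"
    and "(\<Sum>v\<in>verts (strip lo hi). P v) = s"
  shows "solvable_with lo hi s"
  unfolding solvable_with_def pebbling_distribution_def solvable_def distribution_size_def
  by (intro exI[of _ P]) (use assms in \<open>simp add: reachable_iff_gatherable\<close>)

text \<open>
  Each part is solved inside its own strip, so nothing has to cross the boundary.
\<close>

lemma solvable_with_append:
  assumes "solvable_with lo m s" "solvable_with (m + 1) hi s'" "lo \<le> m + 1" "m \<le> hi"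
  shows "solvable_with lo hi (s + s')"
proof -
  let ?V = "verts (strip lo m)" and ?V' = "verts (strip (m + 1) hi)"
  obtain P where P: "\<And>v. v \<notin> ?V \<Longrightarrow> P v = 0" "\<And>v. v \<in> ?V \<Longrightarrow> gatherable (strip lo m) P v 1"
    "sum P ?V = s"
    using assms(1) by (auto simp: solvable_with_def pebbling_distribution_def solvable_def
        distribution_size_def reachable_iff_gatherable)
  obtain P' where P': "\<And>v. v \<notin> ?V' \<Longrightarrow> P' v = 0" "\<And>v. v \<in> ?V' \<Longrightarrow> gatherable (strip (m + 1) hi) P' v 1"
    "sum P' ?V' = s'"
    using assms(2) by (auto simp: solvable_with_def pebbling_distribution_def solvable_def
        distribution_size_def reachable_iff_gatherable)
  have U: "verts (strip lo hi) = ?V \<union> ?V'" and I: "?V \<inter> ?V' = {}"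
    using assms(3,4) by (auto simp: mem_verts_strip set_eq_iff)
  have "gatherable (strip lo hi) (\<lambda>v. P v + P' v) v 1" if "v \<in> ?V \<union> ?V'" for v
  proof (cases "v \<in> ?V")
    case True
    have "gatherable (strip lo hi) P v 1"
      using P(2)[OF True] by (rule gatherable_subgraph) (use U in \<open>auto simp: adj_strip\<close>)
    then show ?thesis by (rule gatherable_mono) simp
  next
    case False
    have "gatherable (strip (m + 1) hi) P' v 1" using P'(2) that False by blast
    then have "gatherable (strip lo hi) P' v 1"
      by (rule gatherable_subgraph) (use U in \<open>auto simp: adj_strip\<close>)
    then show ?thesis by (rule gatherable_mono) simp
  qed
  moreover have "(\<Sum>v\<in>?V \<union> ?V'. P v + P' v) = s + s'"
  proof -
    have "sum P (?V \<union> ?V') = sum P ?V" "sum P' (?V \<union> ?V') = sum P' ?V'"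
      using P(1) P'(1) by (auto intro!: sum.mono_neutral_right)
    then show ?thesis using P(3) P'(3) by (simp add: sum.distrib)
  qed
  ultimately show ?thesis
    using P(1) P'(1) U by (intro solvable_withI[of lo hi "\<lambda>v. P v + P' v"]) auto
qed

lemma gatherable_neighbour:
  assumes "gatherable (strip lo hi) P u (2 * k)" "grid_dist u v = 1"
    and "u \<in> verts (strip lo hi)" "v \<in> verts (strip lo hi)"
  shows "gatherable (strip lo hi) P v k"
  by (rule gatherable_step[OF assms(1)]) (use assms(2-) in \<open>auto simp: adj_strip grid_dist_def\<close>)

lemma gatherable_meet:
  assumes "gatherable (strip lo hi) P u 2" "gatherable (strip lo hi) P' u' 2"
    and "u \<in> verts (strip lo hi)" "u' \<in> verts (strip lo hi)" "x \<in> verts (strip lo hi)"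
    and "grid_dist u x = 1" "grid_dist u' x = 1"
  shows "gatherable (strip lo hi) (\<lambda>v. P v + P' v) x 2"
proof -
  have "gatherable (strip lo hi) P x 1" "gatherable (strip lo hi) P' x 1"
    using gatherable_neighbour[of lo hi P u 1 x] gatherable_neighbour[of lo hi P' u' 1 x] assms
    by simp_all
  from gatherable_add[OF this] show ?thesis by (simp only: one_add_one)
qed

lemma gatherable_present: "k \<le> P v \<Longrightarrow> gatherable G P v k"
  by (auto simp: gatherable_def)

lemma gatherable_within_1:
  assumes "gatherable (strip lo hi) P u 2" "grid_dist u v \<le> 1"
    and "u \<in> verts (strip lo hi)" "v \<in> verts (strip lo hi)"
  shows "gatherable (strip lo hi) P v 1"
proof (cases "u = v")
  case True
  with assms(1) show ?thesis
    unfolding gatherable_def by (meson le_trans one_le_numeral)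
next
  case False
  then have "grid_dist u v = 1"
    using assms(2) by (cases u; cases v) (auto simp: grid_dist_def)
  then show ?thesis using gatherable_neighbour[of lo hi P u 1 v] assms by simp
qed

text \<open>
  If the whole neighbourhood of \<open>u\<close> lies in the strip, every vertex at distance two has a common
  neighbour with \<open>u\<close> there.
\<close>

lemma gatherable_within_2:
  assumes "4 \<le> P u" "grid_dist u v \<le> 2" "v \<in> verts (strip lo hi)" "u \<in> verts (strip lo hi)"
    and nb: "\<And>w. grid_dist u w = 1 \<Longrightarrow> w \<in> verts (strip lo hi)"
  shows "gatherable (strip lo hi) P v 1"
proof (cases "grid_dist u v \<le> 1")
  case True
  then show ?thesis
    using assms(1,3,4) by (intro gatherable_within_1[of lo hi P u v] gatherable_present) auto
next
  case False
  define w where "w = (if fst u = fst v then (fst u, snd u + sgn (snd v - snd u))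
                       else (fst u + sgn (fst v - fst u), snd u))"
  have w: "grid_dist u w = 1" "grid_dist w v = 1"
    using False assms(2) by (auto simp: w_def grid_dist_def sgn_if split: if_splits)
  have "gatherable (strip lo hi) P w 2"
    by (rule gatherable_neighbour[OF _ w(1) assms(4) nb[OF w(1)]])
      (use assms(1) in \<open>simp add: gatherable_present\<close>)
  then show ?thesis
    using gatherable_within_1 w(2) nb[OF w(1)] assms(3) by simp
qed

lemma sum_stack: "finite V \<Longrightarrow> v \<in> V \<Longrightarrow> (\<Sum>u\<in>V. stack v k u) = k"
  by (simp add: stack_def)

text \<open>
  The stack stands on the middle vertex of column \<open>2 * m + 1\<close>. The vertices at distance at most
  two from it are exactly those of the five columns around it. As all shortest paths use the three
  inner columns, the outer ones may be cut off.
\<close>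

lemma solvable_with_block_odd:
  assumes "lo \<in> {2 * m - 1..2 * m}" "hi \<in> {2 * m + 2..2 * m + 3}"
  shows "solvable_with lo hi 4"
proof (rule solvable_withI[of lo hi "stack (m + 2, 1 - m) 4"])
  have c: "(m + 2, 1 - m) \<in> verts (strip lo hi)"
    using assms by (simp add: mem_verts_strip)
  then show "(\<Sum>v\<in>verts (strip lo hi). stack (m + 2, 1 - m) 4 v) = 4"
    by (simp add: sum_stack)
  show "stack (m + 2, 1 - m) 4 v = 0" if "v \<notin> verts (strip lo hi)" for v
    using c that by (auto simp: stack_def)
  show "gatherable (strip lo hi) (stack (m + 2, 1 - m) 4) v 1" if "v \<in> verts (strip lo hi)" for v
    by (rule gatherable_within_2[of _ "(m + 2, 1 - m)"])
      (use that assms c in \<open>auto simp: stack_def mem_verts_strip grid_dist_def\<close>)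
qed

text \<open>
  An even column has no middle vertex. Two pebbles are put on each of its two vertices instead,
  and one pebble from each can meet on either of the two common neighbours \<open>w\<close>, \<open>w'\<close>.
\<close>

lemma solvable_with_block_even:
  assumes "lo \<in> {2 * m - 2..2 * m - 1}" "hi \<in> {2 * m + 1..2 * m + 2}"
  shows "solvable_with lo hi 4"
proof -
  define u u' :: "int \<times> int" where "u = (m + 1, 1 - m)" and "u' = (m + 2, 2 - m)"
  define w w' :: "int \<times> int" where "w = (m + 2, 1 - m)" and "w' = (m + 1, 2 - m)"
  note defs = u_def u'_def w_def w'_def
  let ?G = "strip lo hi" and ?P = "\<lambda>v. stack u 2 v + stack u' 2 v"
  have V: "u \<in> verts ?G" "u' \<in> verts ?G" "w \<in> verts ?G" "w' \<in> verts ?G"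
    using assms by (auto simp: mem_verts_strip defs)
  have common: "gatherable ?G ?P x 2" if "x \<in> {w, w'}" for x
  proof -
    have x: "x \<in> verts ?G" "grid_dist u x = 1" "grid_dist u' x = 1"
      using that V by (auto simp: grid_dist_def defs)
    show ?thesis
      by (rule gatherable_meet[OF gatherable_stack gatherable_stack V(1,2) x])
  qed
  show ?thesis
  proof (rule solvable_withI[of lo hi ?P])
    show "(\<Sum>v\<in>verts ?G. ?P v) = 4"
      using V by (simp add: sum.distrib sum_stack)
    show "?P v = 0" if "v \<notin> verts ?G" for v
      using V that by (auto simp: stack_def)
    fix v assume v: "v \<in> verts ?G"
    have "\<exists>x\<in>{u, u', w, w'}. grid_dist x v \<le> 1"
    proof -
      \<comment> \<open>Relative to \<open>m\<close> only finitely many positions remain, and each is checked.\<close>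
      define a b where "a = fst v - m" and "b = snd v + m"
      have v_eq: "v = (m + a, b - m)" by (simp add: a_def b_def)
      have ab: "a + b \<in> {1..5}" "a - b \<in> {-2..2}"
        using v assms by (auto simp: v_eq mem_verts_strip)
      then have "a \<in> {0..3}" "b \<in> {0..3}" by auto
      then have "a = 0 \<or> a = 1 \<or> a = 2 \<or> a = 3" "b = 0 \<or> b = 1 \<or> b = 2 \<or> b = 3" by auto
      with ab show ?thesis
        by (elim disjE) (simp_all add: v_eq grid_dist_def defs)
    qed
    then obtain x where x: "x \<in> {u, u', w, w'}" "grid_dist x v \<le> 1" by blast
    have "gatherable ?G ?P x 2"
    proof (cases "x \<in> {w, w'}")
      case False
      then have "2 \<le> ?P x" using x(1) by (auto simp: stack_def)
      then show ?thesis by (rule gatherable_present)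
    qed (rule common)
    then show "gatherable ?G ?P v 1"
      using gatherable_within_1[OF _ x(2)] x(1) V v by blast
  qed
qed

lemma solvable_with_block:
  assumes "lo \<in> {t - 2..t - 1}" "hi \<in> {t + 1..t + 2}"
  shows "solvable_with lo hi 4"
proof (cases "even t")
  case True
  then obtain m where "t = 2 * m" by (elim evenE)
  then show ?thesis using assms solvable_with_block_even by simp
next
  case False
  then obtain m where "t = 2 * m + 1" by (elim oddE)
  then show ?thesis using assms solvable_with_block_odd[of lo m hi] by simp
qed

text \<open>
  The stack of four sends one pebble to the vertex \<open>y\<close> two columns further on, where it joins
  a pebble that waits there.
\<close>

lemma gatherable_chain:
  fixes m :: int
  defines "x \<equiv> (m + 2, 1 - m)" and "y \<equiv> (m + 3, - m)"
  assumes "lo \<le> 2 * m" "2 * m + 3 \<le> hi"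
  shows "gatherable (strip lo hi) (\<lambda>v. stack x 4 v + stack y 1 v) y 2"
proof -
  let ?w = "(m + 3, 1 - m)" and ?G = "strip lo hi"
  have V: "x \<in> verts ?G" "y \<in> verts ?G" "?w \<in> verts ?G"
    using assms(3,4) by (auto simp: x_def y_def mem_verts_strip)
  have "gatherable ?G (stack x 4) ?w 2"
    using gatherable_neighbour[of lo hi "stack x 4" x 2 ?w] V
    by (simp add: gatherable_stack x_def grid_dist_def)
  then have "gatherable ?G (stack x 4) y 1"
    using gatherable_neighbour[of lo hi "stack x 4" ?w 1 y] V
    by (simp add: y_def grid_dist_def)
  then have "gatherable ?G (\<lambda>v. stack x 4 v + stack y 1 v) y (1 + 1)"
    using gatherable_stack by (rule gatherable_add)
  then show ?thesis by (simp only: one_add_one)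
qed

text \<open>
  The waiting pebble extends the block of five columns by one column.
\<close>

lemma solvable_with_6_odd: "solvable_with (2 * m - 1) (2 * m + 4) 5"
proof -
  define x y :: "int \<times> int" where "x = (m + 2, 1 - m)" and "y = (m + 3, - m)"
  let ?G = "strip (2 * m - 1) (2 * m + 4)" and ?P = "\<lambda>v. stack x 4 v + stack y 1 v"
  have V: "x \<in> verts ?G" "y \<in> verts ?G" by (auto simp: mem_verts_strip x_def y_def)
  have y2: "gatherable ?G ?P y 2"
    using gatherable_chain[of "2 * m - 1" m "2 * m + 4"] by (simp add: x_def y_def)
  show ?thesis
  proof (rule solvable_withI[of _ _ ?P])
    show "(\<Sum>v\<in>verts ?G. ?P v) = 5" using V by (simp add: sum.distrib sum_stack)
    show "?P v = 0" if "v \<notin> verts ?G" for v using V that by (auto simp: stack_def)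
    fix v assume v: "v \<in> verts ?G"
    show "gatherable ?G ?P v 1"
    proof (cases "grid_dist x v \<le> 2")
      case True
      show ?thesis
        by (rule gatherable_within_2[OF _ True v V(1)])
          (auto simp: stack_def mem_verts_strip grid_dist_def x_def)
    next
      case False
      define a b where "a = fst v - m" and "b = snd v + m"
      have v_eq: "v = (m + a, b - m)" by (simp add: a_def b_def)
      have ab: "a + b \<in> {1..5}" "a - b \<in> {-1..4}"
        using v by (auto simp: v_eq mem_verts_strip)
      then have "a \<in> {0..4}" "b \<in> {-1..3}" by auto
      then have "a = 0 \<or> a = 1 \<or> a = 2 \<or> a = 3 \<or> a = 4"
        "b = -1 \<or> b = 0 \<or> b = 1 \<or> b = 2 \<or> b = 3" by auto
      with ab False have "grid_dist y v \<le> 1"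
        by (elim disjE) (simp_all add: v_eq grid_dist_def x_def y_def)
      then show ?thesis using gatherable_within_1[OF y2] V v by blast
    qed
  qed
qed

text \<open>
  Two further pebbles on \<open>z\<close> serve two more columns. The outer vertices of the column of \<open>z\<close> are
  the critical ones: they are reached because the two pebbles gathered on \<open>y\<close> and the two on \<open>z\<close>
  can send one pebble each to the common neighbours \<open>w\<close> and \<open>w'\<close>.
\<close>

lemma solvable_with_7_8_odd:
  assumes "hi \<in> {2 * m + 5..2 * m + 6}"
  shows "solvable_with (2 * m - 1) hi 7"
proof -
  define x y z :: "int \<times> int"
    where "x = (m + 2, 1 - m)" and "y = (m + 3, - m)" and "z = (m + 4, - 1 - m)"
  define w w' :: "int \<times> int" where "w = (m + 3, - 1 - m)" and "w' = (m + 4, - m)"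
  note defs = x_def y_def z_def w_def w'_def
  let ?G = "strip (2 * m - 1) hi" and ?P = "\<lambda>v. stack x 4 v + stack y 1 v + stack z 2 v"
  have V: "x \<in> verts ?G" "y \<in> verts ?G" "z \<in> verts ?G" "w \<in> verts ?G" "w' \<in> verts ?G"
    using assms by (auto simp: mem_verts_strip defs)
  have y2: "gatherable ?G (\<lambda>v. stack x 4 v + stack y 1 v) y 2"
    using gatherable_chain[of "2 * m - 1" m hi] assms by (simp add: x_def y_def)
  have common: "gatherable ?G ?P u 2" if "u \<in> {w, w'}" for u
  proof -
    have u: "u \<in> verts ?G" "grid_dist y u = 1" "grid_dist z u = 1"
      using that V by (auto simp: grid_dist_def defs)
    show ?thesis
      by (rule gatherable_meet[OF y2 gatherable_stack V(2,3) u])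
  qed
  show ?thesis
  proof (rule solvable_withI[of _ _ ?P])
    show "(\<Sum>v\<in>verts ?G. ?P v) = 7" using V by (simp add: sum.distrib sum_stack)
    show "?P v = 0" if "v \<notin> verts ?G" for v using V that by (auto simp: stack_def)
    fix v assume v: "v \<in> verts ?G"
    show "gatherable ?G ?P v 1"
    proof (cases "grid_dist x v \<le> 2")
      case True
      show ?thesis
        by (rule gatherable_within_2[OF _ True v V(1)])
          (use assms in \<open>auto simp: stack_def mem_verts_strip grid_dist_def x_def\<close>)
    next
      case False
      define a b where "a = fst v - m" and "b = snd v + m"
      have v_eq: "v = (m + a, b - m)" by (simp add: a_def b_def)
      have ab: "a + b \<in> {1..5}" "a - b \<in> {-1..6}"
        using v assms by (auto simp: v_eq mem_verts_strip)
      then have "a \<in> {0..5}" "b \<in> {-2..3}" by auto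
      then have "a = 0 \<or> a = 1 \<or> a = 2 \<or> a = 3 \<or> a = 4 \<or> a = 5"
        "b = -2 \<or> b = -1 \<or> b = 0 \<or> b = 1 \<or> b = 2 \<or> b = 3" by auto
      with ab False have "\<exists>u\<in>{z, w, w'}. grid_dist u v \<le> 1"
        by (elim disjE) (simp_all add: v_eq grid_dist_def defs)
      then obtain u where u: "u \<in> {z, w, w'}" "grid_dist u v \<le> 1" by blast
      have "gatherable ?G ?P u 2"
      proof (cases "u \<in> {w, w'}")
        case False
        then have "2 \<le> ?P u" using u(1) by (auto simp: stack_def)
        then show ?thesis by (rule gatherable_present)
      qed (rule common)
      then show ?thesis using gatherable_within_1[OF _ u(2)] u(1) V v by blast
    qed
  qed
qed

lemma gatherable_swap:
  fixes G H :: "('a \<times> 'a) graph"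
  assumes "gatherable G P v k" "\<And>u w. adj G u w \<Longrightarrow> adj H (prod.swap u) (prod.swap w)"
  shows "gatherable H (P \<circ> prod.swap) (prod.swap v) k"
proof -
  obtain Q where Q: "(pebbling_move G)\<^sup>*\<^sup>* P Q" "k \<le> Q v"
    using assms(1) by (auto simp: gatherable_def)
  from Q(1) have "(pebbling_move H)\<^sup>*\<^sup>* (P \<circ> prod.swap) (Q \<circ> prod.swap)"
  proof (induction rule: rtranclp_induct)
    case (step Q Q')
    from step.hyps(2) obtain u w where uw: "adj G u w" "2 \<le> Q u" "Q' = Q(u := Q u - 2, w := Q w + 1)"
      by (auto simp: pebbling_move_def)
    have swap_eq: "prod.swap x = y \<longleftrightarrow> x = prod.swap y" for x y :: "'a \<times> 'a"
      by (metis swap_swap)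
    have upd: "Q' \<circ> prod.swap = (Q \<circ> prod.swap)(prod.swap u := (Q \<circ> prod.swap) (prod.swap u) - 2,
        prod.swap w := (Q \<circ> prod.swap) (prod.swap w) + 1)"
      unfolding uw(3) by (rule ext) (simp add: swap_eq)
    have "pebbling_move H (Q \<circ> prod.swap) (Q' \<circ> prod.swap)"
      unfolding pebbling_move_def
      by (rule exI[of _ "prod.swap u"], rule exI[of _ "prod.swap w"])
        (use upd uw(1,2) assms(2) in simp)
    then show ?case by (rule rtranclp.rtrancl_into_rtrancl[OF step.IH])
  qed simp
  with Q(2) show ?thesis unfolding gatherable_def by (intro exI[of _ "Q \<circ> prod.swap"]) simp
qed

text \<open>
  Swapping the coordinates reverses the order of the columns. A strip of even length that begins
  with an even column becomes one that begins with an odd column.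
\<close>

lemma solvable_with_mirror:
  assumes "solvable_with lo hi s"
  shows "solvable_with (- hi) (- lo) s"
proof -
  let ?G = "strip lo hi" and ?H = "strip (- hi) (- lo)"
  obtain P where P: "\<And>v. v \<notin> verts ?G \<Longrightarrow> P v = 0" "\<And>v. v \<in> verts ?G \<Longrightarrow> gatherable ?G P v 1"
    "sum P (verts ?G) = s"
    using assms by (auto simp: solvable_with_def pebbling_distribution_def solvable_def
        distribution_size_def reachable_iff_gatherable)
  have V: "prod.swap v \<in> verts ?G \<longleftrightarrow> v \<in> verts ?H" for v
    by (auto simp: mem_verts_strip)
  show ?thesis
  proof (rule solvable_withI[of _ _ "P \<circ> prod.swap"])
    show "(P \<circ> prod.swap) v = 0" if "v \<notin> verts ?H" for v
      using that P(1) V by simp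
    show "gatherable ?H (P \<circ> prod.swap) v 1" if "v \<in> verts ?H" for v
    proof -
      have "gatherable ?H (P \<circ> prod.swap) (prod.swap (prod.swap v)) 1"
      proof (rule gatherable_swap)
        show "gatherable ?G P (prod.swap v) 1" using P(2) V that by blast
        show "adj ?H (prod.swap u) (prod.swap w)" if "adj ?G u w" for u w
          using that V[of "prod.swap u"] V[of "prod.swap w"] by (auto simp: adj_strip)
      qed
      then show ?thesis by simp
    qed
    have "verts ?G = prod.swap ` verts ?H"
    proof (rule set_eqI)
      show "x \<in> verts ?G \<longleftrightarrow> x \<in> prod.swap ` verts ?H" for x
        using V[of "prod.swap x"] V image_eqI[of x prod.swap "prod.swap x" "verts ?H"] by auto
    qed
    then have "sum P (verts ?G) = sum (P \<circ> prod.swap) (verts ?H)"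
      by (simp add: sum.reindex)
    then show "(\<Sum>v\<in>verts ?H. (P \<circ> prod.swap) v) = s" using P(3) by simp
  qed
qed

lemma solvable_with_6: "solvable_with lo (lo + 5) 5"
proof (cases "even lo")
  case False
  then obtain m where "lo = 2 * (m - 1) + 1" by (metis add_diff_cancel_right' oddE)
  then have lo: "lo = 2 * m - 1" by simp
  show ?thesis using solvable_with_6_odd[of m] by (simp add: lo add.commute)
next
  case True
  then obtain m where m: "lo = 2 * m" by (elim evenE)
  have "- (lo + 5) = 2 * (- m - 2) - 1" "- lo = 2 * (- m - 2) + 4" using m by simp_all
  then have "solvable_with (- (lo + 5)) (- lo) 5"
    by (simp only: solvable_with_6_odd)
  from solvable_with_mirror[OF this] show ?thesis by (simp only: minus_minus)
qed

lemma solvable_with_8: "solvable_with lo (lo + 7) 7"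
proof (cases "even lo")
  case False
  then obtain m where "lo = 2 * (m - 1) + 1" by (metis add_diff_cancel_right' oddE)
  then have lo: "lo = 2 * m - 1" by simp
  show ?thesis using solvable_with_7_8_odd[of "lo + 7" m] by (simp add: lo add.commute)
next
  case True
  then obtain m where m: "lo = 2 * m" by (elim evenE)
  have "- (lo + 7) = 2 * (- m - 3) - 1" using m by simp
  then have "solvable_with (- (lo + 7)) (- lo) 7"
    by (simp only:) (rule solvable_with_7_8_odd, simp add: m)
  from solvable_with_mirror[OF this] show ?thesis by (simp only: minus_minus)
qed

lemma solvable_with_add_blocks:
  assumes "solvable_with lo hi s" "lo \<le> hi"
  shows "solvable_with lo (hi + 5 * int k) (s + 4 * k)"
proof (induction k)
  case (Suc k)
  let ?h = "hi + 5 * int k"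
  have "solvable_with (?h + 1) (?h + 5) 4" by (rule solvable_with_block[of _ "?h + 3"]) auto
  then have "solvable_with lo (?h + 5) (s + 4 * k + 4)"
    using solvable_with_append[OF Suc] assms(2) by simp
  then show ?case by (simp add: algebra_simps)
qed (use assms in simp)

lemma solvable_with_4k_plus_r:
  assumes "r \<in> {0, 1, 2, 3, 4}" "5 * k + r \<ge> 1" "5 * k + r \<notin> {1, 2, 3, 7}"
  shows "solvable_with lo (lo + int (5 * k + r) - 1) (4 * k + r)"
proof -
  have b5: "solvable_with lo (lo + 4) 4" and b4: "solvable_with lo (lo + 3) 4"
    by (rule solvable_with_block[of _ "lo + 2"]; simp)+
  \<comment> \<open>A remainder of two is made up of two blocks of six columns, which takes \<open>k \<ge> 2\<close>.\<close>
  have "solvable_with (lo + 5 + 1) (lo + 11) 5"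
    using solvable_with_6[of "lo + 6"] by (simp add: algebra_simps)
  then have b12: "solvable_with lo (lo + 11) 10"
    using solvable_with_append[OF solvable_with_6] by fastforce
  consider j where "r = 0" "k = Suc j" | j where "r = 1" "k = Suc j"
    | j where "r = 2" "k = Suc (Suc j)" | j where "r = 3" "k = Suc j" | "r = 4"
    using assms by (cases k; cases "k - 1") auto
  then show ?thesis
  proof cases
    case 1
    then show ?thesis using solvable_with_add_blocks[OF b5, of j] by (simp add: algebra_simps)
  next
    case 2
    then show ?thesis
      using solvable_with_add_blocks[OF solvable_with_6, of lo j] by (simp add: algebra_simps)
  next
    case 3
    then show ?thesis using solvable_with_add_blocks[OF b12, of j] by (simp add: algebra_simps)
  next
    case 4
    then show ?thesis
      using solvable_with_add_blocks[OF solvable_with_8, of lo j] by (simp add: algebra_simps)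
  next
    case 5
    then show ?thesis using solvable_with_add_blocks[OF b4, of k] by (simp add: algebra_simps)
  qed
qed

section \<open>Supplies of columns\<close>

text \<open>
  Passing pebbles to the next column halves their number, so \<open>left_supply lo c t\<close> is the largest
  number of pebbles that the columns up to \<open>t\<close> alone could collect in column \<open>t\<close> if all pebbles
  of a column were on the same vertex. The capacity is the corresponding bound when both
  sides contribute.
\<close>

function left_supply :: "int \<Rightarrow> (int \<Rightarrow> nat) \<Rightarrow> int \<Rightarrow> nat" where
  "left_supply lo c t = (if t < lo then 0 else c t + left_supply lo c (t - 1) div 2)"
  by auto
termination by (relation "measure (\<lambda>(lo, c, t). nat (t - lo + 1))") auto

declare left_supply.simps [simp del]

definition right_supply :: "int \<Rightarrow> (int \<Rightarrow> nat) \<Rightarrow> int \<Rightarrow> nat" where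
  "right_supply hi c t = left_supply (- hi) (\<lambda>s. c (- s)) (- t)"

definition capacity :: "int \<Rightarrow> int \<Rightarrow> (int \<Rightarrow> nat) \<Rightarrow> int \<Rightarrow> nat" where
  "capacity lo hi c t = left_supply lo c (t - 1) div 2 + c t + right_supply hi c (t + 1) div 2"

lemma left_supply_outside: "t < lo \<Longrightarrow> left_supply lo c t = 0"
  by (subst left_supply.simps) simp

lemma right_supply_outside: "hi < t \<Longrightarrow> right_supply hi c t = 0"
  by (simp add: right_supply_def left_supply_outside)

lemma left_supply_rec:
  assumes "\<And>t. t < lo \<Longrightarrow> c t = 0"
  shows "left_supply lo c t = c t + left_supply lo c (t - 1) div 2"
  using assms by (subst left_supply.simps) (simp add: left_supply_outside)

lemma right_supply_rec:
  assumes "\<And>t. hi < t \<Longrightarrow> c t = 0"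
  shows "right_supply hi c t = c t + right_supply hi c (t + 1) div 2"
  unfolding right_supply_def
  using left_supply_rec[of "- hi" "\<lambda>s. c (- s)" "- t"] assms by simp

lemma div2_shift:
  fixes x y :: nat
  shows "x \<le> y \<Longrightarrow> x div 2 \<le> y div 2" "x + 2 \<le> y \<Longrightarrow> x div 2 + 1 \<le> y div 2"
    "x \<le> y + 1 \<Longrightarrow> x div 2 \<le> y div 2 + 1"
  by linarith+

text \<open>
  A pebble moved to the right leaves the supplies beyond it unchanged, since the loss of two
  pebbles is halved at the next step. A pebble moved to the left is counted as a gain only
  in the column that it enters, because there it comes from outside the part that the supply
  describes. The extra summands record the exact changes that carry the induction.
\<close>

lemma left_supply_move:
  assumes "\<And>t. t < lo \<Longrightarrow> c t = 0" "2 \<le> c k" "\<bar>k - k'\<bar> = 1" "lo \<le> k'"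
    and c': "c' = c(k := c k - 2, k' := c k' + 1)"
  shows "left_supply lo c' t + (if t = k \<and> k < k' then 2 else 0)
       \<le> left_supply lo c t + (if t = k' \<and> k' < k then 1 else 0)"
proof (cases "t < lo")
  case True
  have "lo \<le> k" using assms(1)[of k] assms(2) by fastforce
  with True show ?thesis by (simp add: left_supply_outside)
next
  case False
  have "lo \<le> k" using assms(1)[of k] assms(2) by fastforce
  have zero': "c' s = 0" if "s < lo" for s
    using assms(1)[of s] that \<open>lo \<le> k\<close> assms(4) by (auto simp: c')
  note rec = left_supply_rec[of lo c, OF assms(1)] and rec' = left_supply_rec[of lo c', OF zero']
  have cv: "c' k + 2 = c k" "c' k' = c k' + 1" "\<And>s. s \<noteq> k \<Longrightarrow> s \<noteq> k' \<Longrightarrow> c' s = c s"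
    using assms(2,3) by (auto simp: c')
  from False have "lo - 1 \<le> t" by simp
  then show ?thesis
  proof (induction t rule: int_ge_induct)
    case base
    then show ?case using \<open>lo \<le> k\<close> by (simp add: left_supply_outside)
  next
    case (step i)
    have r: "left_supply lo c (i + 1) = c (i + 1) + left_supply lo c i div 2"
      "left_supply lo c' (i + 1) = c' (i + 1) + left_supply lo c' i div 2"
      using rec[of "i + 1"] rec'[of "i + 1"] by simp_all
    note half = div2_shift[of "left_supply lo c' i" "left_supply lo c i"]
    consider "i + 1 = k" "k' = k + 1" | "i + 1 = k" "k' = k - 1" | "i = k" "k' = k + 1"
      | "i + 1 = k'" "k' = k - 1" | "i + 1 \<noteq> k" "i + 1 \<noteq> k'"
      using assms(3) by linarith
    then show ?case
    proof cases
      case 1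
      then have "left_supply lo c' i \<le> left_supply lo c i" using step.IH by simp
      with half(1) 1 assms(2) cv show ?thesis unfolding r by simp
    next
      case 2
      then have "left_supply lo c' i \<le> left_supply lo c i + 1" using step.IH by simp
      with half(3) 2 assms(2) cv show ?thesis unfolding r by simp
    next
      case 3
      then have "left_supply lo c' i + 2 \<le> left_supply lo c i" using step.IH by simp
      with half(2) 3 cv show ?thesis unfolding r by simp
    next
      case 4
      then have "left_supply lo c' i \<le> left_supply lo c i" using step.IH by simp
      with half(1) 4 cv(2)[folded 4(1)] show ?thesis unfolding r by simp
    next
      case 5
      then have "left_supply lo c' i \<le> left_supply lo c i"
        using step.IH assms(3) by (auto split: if_splits)
      with half(1) 5 cv show ?thesis unfolding r by simp
    qed
  qed
qed

lemma right_supply_move: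
  assumes "\<And>t. hi < t \<Longrightarrow> c t = 0" "2 \<le> c k" "\<bar>k - k'\<bar> = 1" "k' \<le> hi"
    and c': "c' = c(k := c k - 2, k' := c k' + 1)"
  shows "right_supply hi c' t + (if t = k \<and> k' < k then 2 else 0)
       \<le> right_supply hi c t + (if t = k' \<and> k < k' then 1 else 0)"
proof -
  have "(\<lambda>s. c' (- s)) = (\<lambda>s. c (- s))(- k := c (- (- k)) - 2, - k' := c (- (- k')) + 1)"
    by (auto simp: c' fun_eq_iff)
  from left_supply_move[OF _ _ _ _ this, of "- hi" "- t"] assms(1-4)
  show ?thesis by (simp add: right_supply_def)
qed

text \<open>
  Of two pebbles that leave column \<open>t\<close> in a move at most one can come back, hence the strict
  decrease for \<open>k = t\<close>.
\<close>

lemma capacity_move: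
  assumes "\<And>t. t \<notin> {lo..hi} \<Longrightarrow> c t = 0" "2 \<le> c k" "\<bar>k - k'\<bar> = 1" "k' \<in> {lo..hi}"
    and c': "c' = c(k := c k - 2, k' := c k' + 1)"
  shows "capacity lo hi c' t + (if t = k then 1 else 0) \<le> capacity lo hi c t"
proof -
  have l: "left_supply lo c' (t - 1) + (if t - 1 = k \<and> k < k' then 2 else 0)
       \<le> left_supply lo c (t - 1) + (if t - 1 = k' \<and> k' < k then 1 else 0)"
    by (rule left_supply_move[OF _ assms(2,3) _ c']) (use assms(1,4) in auto)
  have r: "right_supply hi c' (t + 1) + (if t + 1 = k \<and> k' < k then 2 else 0)
       \<le> right_supply hi c (t + 1) + (if t + 1 = k' \<and> k < k' then 1 else 0)"
    by (rule right_supply_move[OF _ assms(2,3) _ c']) (use assms(1,4) in auto)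
  have cv: "c' k + 2 = c k" "c' k' = c k' + 1" "\<And>s. s \<noteq> k \<Longrightarrow> s \<noteq> k' \<Longrightarrow> c' s = c s"
    using assms(2,3) by (auto simp: c')
  note half = div2_shift[of "left_supply lo c' (t - 1)" "left_supply lo c (t - 1)"]
    div2_shift[of "right_supply hi c' (t + 1)" "right_supply hi c (t + 1)"]
  consider "t = k" "k' = k - 1" | "t = k" "k' = k + 1" | "t = k'" "k' = k + 1" | "t = k'" "k' = k - 1"
    | "t \<noteq> k" "t \<noteq> k'"
    using assms(3) by linarith
  then show ?thesis
  proof cases
    case 1
    then have "left_supply lo c' (t - 1) \<le> left_supply lo c (t - 1) + 1"
      "right_supply hi c' (t + 1) \<le> right_supply hi c (t + 1)" using l r by auto
    with half(3,4) 1 cv(1) show ?thesis unfolding capacity_def by simp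
  next
    case 2
    then have "left_supply lo c' (t - 1) \<le> left_supply lo c (t - 1)"
      "right_supply hi c' (t + 1) \<le> right_supply hi c (t + 1) + 1" using l r by auto
    with half(1,6) 2 cv(1) show ?thesis unfolding capacity_def by simp
  next
    case 3
    then have "left_supply lo c' (t - 1) + 2 \<le> left_supply lo c (t - 1)"
      "right_supply hi c' (t + 1) \<le> right_supply hi c (t + 1)" using l r by auto
    with half(2,4) 3 cv(2) show ?thesis unfolding capacity_def by simp
  next
    case 4
    then have "left_supply lo c' (t - 1) \<le> left_supply lo c (t - 1)"
      "right_supply hi c' (t + 1) + 2 \<le> right_supply hi c (t + 1)" using l r by auto
    with half(1,5) 4 cv(2) show ?thesis unfolding capacity_def by simp
  next
    case 5
    have "left_supply lo c' (t - 1) \<le> left_supply lo c (t - 1)"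
      using l 5 assms(3) by (auto split: if_splits)
    moreover have "right_supply hi c' (t + 1) \<le> right_supply hi c (t + 1)"
      using r 5 assms(3) by (auto split: if_splits)
    ultimately show ?thesis using 5 cv(3) unfolding capacity_def by (simp add: add_mono div_le_mono)
  qed
qed

section \<open>Pebbles that cannot leave a window\<close>

definition column_pebbles :: "(int \<times> int \<Rightarrow> nat) \<Rightarrow> int \<Rightarrow> nat" where
  "column_pebbles P t = (\<Sum>v\<in>cells t. P v)"

lemma weighted_sum_move:
  fixes Q w :: "'a \<Rightarrow> nat"
  assumes "finite W" "u \<noteq> v" "2 \<le> Q u"
  shows "(\<Sum>x\<in>W. w x * (Q(u := Q u - 2, v := Q v + 1)) x) + (if u \<in> W then 2 * w u else 0)
    = (\<Sum>x\<in>W. w x * Q x) + (if v \<in> W then w v else 0)"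
proof -
  obtain q where q: "Q u = q + 2" using assms(3) by (metis add.commute le_Suc_ex)
  have "(\<Sum>x\<in>W. w x * (Q(u := Q u - 2, v := Q v + 1)) x + (if x = u then 2 * w u else 0))
    = (\<Sum>x\<in>W. w x * Q x + (if x = v then w v else 0))"
    using assms(2) by (intro sum.cong) (auto simp: q algebra_simps)
  then show ?thesis using assms(1) by (simp add: sum.distrib)
qed

lemma column_pebbles_move:
  assumes "adj (strip lo hi) u v" "2 \<le> Q u"
  defines "k \<equiv> fst u - snd u" and "k' \<equiv> fst v - snd v"
  shows "\<bar>k - k'\<bar> = 1" "k \<in> {lo..hi}" "k' \<in> {lo..hi}" "2 \<le> column_pebbles Q k"
    "column_pebbles (Q(u := Q u - 2, v := Q v + 1)) =
      (column_pebbles Q)(k := column_pebbles Q k - 2, k' := column_pebbles Q k' + 1)"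
proof -
  have uv: "u \<in> verts (strip lo hi)" "v \<in> verts (strip lo hi)"
    and d: "\<bar>fst u - fst v\<bar> + \<bar>snd u - snd v\<bar> = 1"
    using assms(1) by (auto simp: adj_strip)
  from d show kk: "\<bar>k - k'\<bar> = 1" unfolding k_def k'_def by presburger
  from uv show "k \<in> {lo..hi}" "k' \<in> {lo..hi}" by (simp_all add: mem_verts_strip k_def k'_def)
  have u: "u \<in> cells t \<longleftrightarrow> t = k" and v: "v \<in> cells t \<longleftrightarrow> t = k'" for t
    using uv by (auto simp: mem_verts_strip cells_def k_def k'_def)
  have "Q u \<le> column_pebbles Q k"
    unfolding column_pebbles_def by (rule member_le_sum) (auto simp: u)
  with assms(2) show ge: "2 \<le> column_pebbles Q k" by simp
  have "u \<noteq> v" using kk by (auto simp: k_def k'_def)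
  then have "column_pebbles (Q(u := Q u - 2, v := Q v + 1)) t + (if t = k then 2 else 0)
    = column_pebbles Q t + (if t = k' then 1 else 0)" for t
    using weighted_sum_move[of "cells t" u v Q "\<lambda>_. 1", OF finite_cells _ assms(2)]
    by (simp only: column_pebbles_def u v mult_1 mult_1_right simp_thms)
  then have eq: "column_pebbles (Q(u := Q u - 2, v := Q v + 1)) t
    = column_pebbles Q t + (if t = k' then 1 else 0) - (if t = k then 2 else 0)" for t
    by (metis add_diff_cancel_right')
  show "column_pebbles (Q(u := Q u - 2, v := Q v + 1)) =
      (column_pebbles Q)(k := column_pebbles Q k - 2, k' := column_pebbles Q k' + 1)"
    by (rule ext, subst eq) (use kk in auto)
qed

lemma column_pebbles_outside:
  assumes "pebbling_distribution (strip lo hi) P" "t \<notin> {lo..hi}"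
  shows "column_pebbles P t = 0"
  unfolding column_pebbles_def
  using assms by (intro sum.neutral) (auto simp: pebbling_distribution_def mem_verts_strip cells_def)

text \<open>
  The general form of all impossibility arguments below: a property that is kept by every single
  move holds for all distributions that can be obtained.
\<close>

lemma moves_invariant:
  assumes "(pebbling_move (strip lo hi))\<^sup>*\<^sup>* P Q" "pebbling_distribution (strip lo hi) P" "I P"
    and step: "\<And>Q u v. \<lbrakk>pebbling_distribution (strip lo hi) Q; I Q; adj (strip lo hi) u v; 2 \<le> Q u\<rbrakk>
      \<Longrightarrow> I (Q(u := Q u - 2, v := Q v + 1))"
  shows "I Q"
proof -
  from assms(1) have "pebbling_distribution (strip lo hi) Q \<and> I Q"
  proof (induction rule: rtranclp_induct)
    case base
    then show ?case using assms(2,3) by simp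
  next
    case (step Q Q')
    then obtain u v where uv: "adj (strip lo hi) u v" "2 \<le> Q u" "Q' = Q(u := Q u - 2, v := Q v + 1)"
      by (auto simp: pebbling_move_def)
    then have "pebbling_distribution (strip lo hi) Q'"
      using step.IH by (auto simp: pebbling_distribution_def adj_strip)
    with uv step.IH assms(4) show ?case by blast
  qed
  then show ?thesis by simp
qed

abbreviation left_of :: "int \<Rightarrow> (int \<times> int \<Rightarrow> nat) \<Rightarrow> int \<Rightarrow> nat" where
  "left_of lo P \<equiv> left_supply lo (column_pebbles P)"

abbreviation right_of :: "int \<Rightarrow> (int \<times> int \<Rightarrow> nat) \<Rightarrow> int \<Rightarrow> nat" where
  "right_of hi P \<equiv> right_supply hi (column_pebbles P)"

abbreviation capacity_of :: "int \<Rightarrow> int \<Rightarrow> (int \<times> int \<Rightarrow> nat) \<Rightarrow> int \<Rightarrow> nat" where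
  "capacity_of lo hi P \<equiv> capacity lo hi (column_pebbles P)"

text \<open>
  No pebble ever crosses the boundary of a sealed window: the columns at its two ends can never hold two
  pebbles, and the columns next to it outside do not get two pebbles on their own.
\<close>

definition sealed :: "int \<Rightarrow> int \<Rightarrow> (int \<times> int \<Rightarrow> nat) \<Rightarrow> int \<Rightarrow> int \<Rightarrow> bool" where
  "sealed lo hi P s e \<longleftrightarrow> left_of lo P (s - 1) \<le> 1 \<and> capacity_of lo hi P s \<le> 1 \<and>
     capacity_of lo hi P e \<le> 1 \<and> right_of hi P (e + 1) \<le> 1"

lemma sealed_move:
  assumes dist: "pebbling_distribution (strip lo hi) Q" and sealed: "sealed lo hi Q s e"
    and uv: "adj (strip lo hi) u v" "2 \<le> Q u"
  defines "k \<equiv> fst u - snd u"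
  shows "k \<notin> {s - 1, s, e, e + 1}" "sealed lo hi (Q(u := Q u - 2, v := Q v + 1)) s e"
proof -
  let ?c = "column_pebbles Q" and ?Q' = "Q(u := Q u - 2, v := Q v + 1)"
  define k' where "k' = fst v - snd v"
  note m = column_pebbles_move[of lo hi u v Q, OF uv, folded k_def k'_def]
  have out: "?c t = 0" if "t \<notin> {lo..hi}" for t using column_pebbles_outside[OF dist that] .
  have "?c t \<le> left_of lo Q t" "?c t \<le> right_of hi Q t" for t
    using left_supply_rec[of lo ?c t] right_supply_rec[of hi ?c t] out by auto
  moreover have "?c t \<le> capacity_of lo hi Q t" for t by (simp add: capacity_def)
  ultimately have small: "?c t \<le> 1" if "t \<in> {s - 1, s, e, e + 1}" for t
    using sealed that unfolding sealed_def by (metis (no_types, opaque_lifting) empty_iff insert_iff le_trans)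
  show k: "k \<notin> {s - 1, s, e, e + 1}" using m(4) small by fastforce
  have lo: "lo \<le> k'" and hi: "k' \<le> hi" using m(3) by auto
  have "left_of lo ?Q' (s - 1) \<le> left_of lo Q (s - 1)"
    using left_supply_move[OF _ m(4,1) lo m(5), of "s - 1"] out k m(1) by (auto split: if_splits)
  moreover have "right_of hi ?Q' (e + 1) \<le> right_of hi Q (e + 1)"
    using right_supply_move[OF _ m(4,1) hi m(5), of "e + 1"] out k m(1) by (auto split: if_splits)
  moreover have "capacity_of lo hi ?Q' t \<le> capacity_of lo hi Q t" for t
    using capacity_move[OF out m(4,1,3,5), of t] by simp
  ultimately show "sealed lo hi ?Q' s e"
    using sealed unfolding sealed_def by (meson le_trans)
qed

lemma sealed_weight_decreasing:
  fixes w :: "int \<times> int \<Rightarrow> nat"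
  assumes "(pebbling_move (strip lo hi))\<^sup>*\<^sup>* P Q" "pebbling_distribution (strip lo hi) P"
    and "sealed lo hi P s e" "s \<le> e"
    and w: "\<And>u v. adj (strip lo hi) u v \<Longrightarrow> w v \<le> 2 * w u"
  defines "W \<equiv> \<Union>t\<in>{s..e}. cells t"
  shows "(\<Sum>x\<in>W. w x * Q x) \<le> (\<Sum>x\<in>W. w x * P x)"
proof -
  have "sealed lo hi Q s e \<and> (\<Sum>x\<in>W. w x * Q x) \<le> (\<Sum>x\<in>W. w x * P x)"
  proof (rule moves_invariant[OF assms(1,2)])
    fix Q u v
    assume Q: "pebbling_distribution (strip lo hi) Q"
      "sealed lo hi Q s e \<and> (\<Sum>x\<in>W. w x * Q x) \<le> (\<Sum>x\<in>W. w x * P x)"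
      and uv: "adj (strip lo hi) u v" "2 \<le> Q u"
    let ?Q' = "Q(u := Q u - 2, v := Q v + 1)"
    note m = column_pebbles_move[of lo hi u v Q, OF uv]
    have k: "fst u - snd u \<notin> {s - 1, s, e, e + 1}" and sealed': "sealed lo hi ?Q' s e"
      using sealed_move[OF Q(1) conjunct1[OF Q(2)] uv] by auto
    have "x \<in> W \<longleftrightarrow> fst x - snd x \<in> {s..e}" if "x \<in> verts (strip lo hi)" for x
      using that unfolding W_def mem_verts_strip cells_def by simp
    then have "u \<in> W \<longleftrightarrow> fst u - snd u \<in> {s..e}" "v \<in> W \<longleftrightarrow> fst v - snd v \<in> {s..e}"
      using uv(1) by (simp_all add: adj_strip)
    moreover have "fst u - snd u \<in> {s..e} \<longleftrightarrow> fst v - snd v \<in> {s..e}"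
      using k m(1) by auto
    ultimately have "(\<Sum>x\<in>W. w x * ?Q' x) \<le> (\<Sum>x\<in>W. w x * Q x)"
      using weighted_sum_move[of W u v Q w] uv w[OF uv(1)] m(1) by (force simp: W_def)
    with Q(2) sealed' show "sealed lo hi ?Q' s e \<and> (\<Sum>x\<in>W. w x * ?Q' x) \<le> (\<Sum>x\<in>W. w x * P x)"
      by simp
  qed (use assms(3) in simp)
  then show ?thesis by simp
qed

text \<open>
  This is \<open>16 * 2\<close> to the power of minus the distance, except that it is 1 at all distances
  beyond four. A move trades two pebbles for one on a neighbour, and either way the weight of the
  neighbour is at most twice as large.
\<close>

definition closeness :: "int \<times> int \<Rightarrow> int \<times> int \<Rightarrow> nat" where
  "closeness z v = 2 ^ (4 - nat (grid_dist v z))"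

lemma sealed_closeness:
  assumes "solvable (strip lo hi) P" "pebbling_distribution (strip lo hi) P"
    and "sealed lo hi P s e" and z: "z \<in> cells t" "t \<in> {s..e}" "t \<in> {lo..hi}"
  shows "16 \<le> (\<Sum>t\<in>{s..e}. \<Sum>x\<in>cells t. closeness z x * P x)"
proof -
  let ?W = "\<Union>t\<in>{s..e}. cells t"
  have "z \<in> verts (strip lo hi)" using z by (auto simp: verts_strip)
  then obtain Q where Q: "(pebbling_move (strip lo hi))\<^sup>*\<^sup>* P Q" "1 \<le> Q z"
    using assms(1) by (auto simp: solvable_def reachable_def)
  have "closeness z v \<le> 2 * closeness z u" if "adj (strip lo hi) u v" for u v
  proof -
    have "grid_dist u z \<le> grid_dist v z + 1" "0 \<le> grid_dist v z"
      using that by (auto simp: adj_strip grid_dist_def)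
    then have "4 - nat (grid_dist v z) \<le> Suc (4 - nat (grid_dist u z))" by linarith
    then have "(2 :: nat) ^ (4 - nat (grid_dist v z)) \<le> 2 ^ Suc (4 - nat (grid_dist u z))"
      by (rule power_increasing) simp
    then show ?thesis by (simp add: closeness_def)
  qed
  then have "(\<Sum>x\<in>?W. closeness z x * Q x) \<le> (\<Sum>x\<in>?W. closeness z x * P x)"
    using sealed_weight_decreasing[OF Q(1) assms(2,3)] z(2) by simp
  moreover have "closeness z z * Q z \<le> (\<Sum>x\<in>?W. closeness z x * Q x)"
    by (rule member_le_sum) (use z in auto)
  moreover have "16 \<le> closeness z z * Q z" using Q(2) by (simp add: closeness_def grid_dist_def)
  moreover have "(\<Sum>x\<in>?W. closeness z x * P x) = (\<Sum>t\<in>{s..e}. \<Sum>x\<in>cells t. closeness z x * P x)"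
    by (rule sum.UNION_disjoint) (simp, simp, auto simp: cells_def)
  ultimately show ?thesis by linarith
qed

section \<open>The charging argument\<close>

text \<open>This is \<open>4 * \<lfloor>log\<^sub>2 n\<rfloor>\<close>, and 0 for \<open>n = 0\<close>.\<close>

fun credit :: "nat \<Rightarrow> nat" where
  "credit n = (if n < 2 then 0 else credit (n div 2) + 4)"

declare credit.simps [simp del]

lemma credit_less_2: "n < 2 \<Longrightarrow> credit n = 0"
  and credit_half: "2 \<le> n \<Longrightarrow> credit n = credit (n div 2) + 4"
  by (simp_all add: credit.simps[of n])

lemma credit_small [simp]: "credit 0 = 0" "credit (Suc 0) = 0" "credit 2 = 4" "credit 3 = 4"
  "credit 4 = 8" "credit 5 = 8"
  by (simp_all add: credit_less_2 credit_half)

lemma credit_mono: "m \<le> n \<Longrightarrow> credit m \<le> credit n"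
proof (induction n arbitrary: m rule: less_induct)
  case (less n)
  show ?case
  proof (cases "2 \<le> m")
    case True
    then have "credit (m div 2) \<le> credit (n div 2)"
      using less by (intro less.IH) (auto simp: div_le_mono)
    then show ?thesis using True less.prems by (simp add: credit_half)
  qed (simp add: credit_less_2)
qed

lemma credit_gain: "credit (p + a div 2) \<le> credit p + credit a"
proof -
  consider "a < 2" | "2 \<le> a" "a \<le> 2 * p" | "2 * p < a" by linarith
  then show ?thesis
  proof cases
    case 2
    then have "credit (p + a div 2) \<le> credit (2 * p)" by (intro credit_mono) linarith
    also have "\<dots> = credit p + 4" using 2 by (subst credit_half) auto
    also have "4 \<le> credit a" using 2 by (simp add: credit_half)
    finally show ?thesis by simp
  next
    case 3
    then have "credit (p + a div 2) \<le> credit a" by (intro credit_mono) linarith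
    then show ?thesis by simp
  qed simp
qed

lemma credit_le: "3 \<le> p \<Longrightarrow> 2 * credit p + 4 \<le> 5 * p"
proof (induction p rule: less_induct)
  case (less p)
  show ?case
  proof (cases "p < 6")
    case True
    then have "p = 3 \<or> p = 4 \<or> p = 5" using less.prems by linarith
    then show ?thesis by auto
  next
    case False
    then have "2 * credit (p div 2) + 4 \<le> 5 * (p div 2)" by (intro less.IH) auto
    then show ?thesis using False by (simp add: credit_half)
  qed
qed

lemma credit_less_4: "credit n < 4 \<Longrightarrow> n \<le> 1"
  using credit_half[of n] by fastforce

text \<open>
  Consider a column with \<open>p\<close> pebbles, a supply of \<open>a\<close> from its left and \<open>b\<close> from its right
  neighbour. It receives \<open>pay a p b\<close> from its right neighbour and \<open>pay b p a\<close> from its left one. A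
  column with two pebbles and supplies \<open>0\<close> and \<open>1\<close> is two units short and gets them
  from the side with supply 1; with supplies \<open>1\<close> and \<open>1\<close> it gets one unit from either side.
  The neighbour that pays may hold a single pebble and then has one unit to spare only. The
  clause for \<open>p = 1\<close> gives it another unit from the column behind it.
\<close>

definition pay :: "nat \<Rightarrow> nat \<Rightarrow> nat \<Rightarrow> int" where
  "pay a p b = (if b = 1 \<and> p + a div 2 = 2
     then (if p = 2 then (if a = 0 then 2 else 1) else if p = 1 then 1 else 0) else 0)"

lemma pay_bounds: "0 \<le> pay a p b" "pay a p b \<le> 2"
  by (auto simp: pay_def)

text \<open>
  The left side is the credit that the column adds, seen from both directions, and the
  payments to its two neighbours; these neighbours hold \<open>p'\<close> and \<open>p''\<close> pebbles. An empty
  column gets at least two pebbles from one side, and that supply loses four units of credit by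
  being halved; it has to pay only if both supplies are that large. A column with one pebble does
  not pay to both sides, and by \<open>K3\<close> it owes two
  units only if it gets one back. A column with at least two pebbles pays nothing, because the
  supplies that it passes on exceed 1.
\<close>

lemma column_balance:
  fixes a p b a' p' b'' p'' :: nat
  assumes a: "a = p' + a' div 2" and b: "b = p'' + b'' div 2"
    and K1: "a \<le> 1 \<Longrightarrow> b \<le> 1 \<Longrightarrow> 2 \<le> p" and K2: "a = 0 \<Longrightarrow> b = 0 \<Longrightarrow> p \<noteq> 2"
    and K3: "a' = 0 \<Longrightarrow> b = 0 \<Longrightarrow> \<not> (p' = 2 \<and> p = 1)" "a = 0 \<Longrightarrow> b'' = 0 \<Longrightarrow> \<not> (p = 1 \<and> p'' = 2)"
  shows "int (credit (p + a div 2)) - int (credit a) + int (credit (p + b div 2)) - int (credit b)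
      + pay a' p' (p + b div 2) + pay b'' p'' (p + a div 2)
    \<le> 5 * int p - 4 + pay a p b + pay b p a"
proof -
  consider "p = 0" | "p = 1" | "p = 2" | "3 \<le> p" by linarith
  then show ?thesis
  proof cases
    case 1
    have gain: "credit (x div 2) \<le> credit x" "2 \<le> x \<Longrightarrow> credit (x div 2) + 4 = credit x" for x
      by (simp_all add: credit_mono credit_half)
    have "2 \<le> a \<or> 2 \<le> b" using K1 1 by force
    moreover have "pay a' p' (b div 2) + pay b'' p'' (a div 2) \<le> (if 2 \<le> a \<and> 2 \<le> b then 4 else 0)"
      using pay_bounds[of a' p' "b div 2"] pay_bounds[of b'' p'' "a div 2"]
      by (auto simp: pay_def a b)
    ultimately show ?thesis
      using 1 gain[of a] gain[of b] pay_bounds[of a p b] pay_bounds[of b p a]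
      by (auto split: if_splits)
  next
    case 2
    have gain: "credit (Suc (x div 2)) \<le> credit x" for x
    proof (cases "x < 2")
      case False
      then show ?thesis by (intro credit_mono) linarith
    qed (simp add: credit_less_2)
    have pass: "pay x' q (1 + y div 2) \<le> 1 + pay x 1 y"
      if "x = q + x' div 2" "x' = 0 \<Longrightarrow> y = 0 \<Longrightarrow> q \<noteq> 2" for x x' q y
    proof (cases "y \<le> 1 \<and> x = 2")
      case True
      then have "y = 0 \<or> y = 1" by linarith
      then show ?thesis using True that by (auto simp: pay_def)
    next
      case False
      then have "pay x' q (1 + y div 2) = 0" using that(1) by (auto simp: pay_def)
      then show ?thesis using pay_bounds(1)[of x 1 y] by simp
    qed
    have "pay x' q (1 + x div 2) = 0" if "2 \<le> x" for x' q x :: nat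
      using that by (simp add: pay_def div_eq_0_iff)
    moreover have "2 \<le> a \<or> 2 \<le> b" using K1 2 by force
    ultimately have "pay a' p' (1 + b div 2) = 0 \<or> pay b'' p'' (1 + a div 2) = 0" by blast
    then have "pay a' p' (1 + b div 2) + pay b'' p'' (1 + a div 2) \<le> 1 + pay a 1 b + pay b 1 a"
      using pass[of a p' a' b] pass[of b p'' b'' a] a b K3 2
        pay_bounds(1)[of a 1 b] pay_bounds(1)[of b 1 a] by auto
    then show ?thesis using 2 gain[of a] gain[of b] by simp
  next
    case 3
    have gain: "credit (Suc (Suc (x div 2))) \<le> credit x + (if x < 2 then 4 else 0)" for x
    proof -
      consider "x < 2" | "x = 2 \<or> x = 3" | "4 \<le> x" by linarith
      then show ?thesis
      proof cases
        case 3
        then show ?thesis using credit_mono[of "Suc (Suc (x div 2))" x] by simp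
      qed (auto simp: credit_less_2 numeral_2_eq_2[symmetric] numeral_3_eq_3[symmetric])
    qed
    have "pay a' p' (2 + b div 2) = 0" "pay b'' p'' (2 + a div 2) = 0" by (auto simp: pay_def)
    moreover have "2 \<le> pay a 2 b + pay b 2 a" if "a < 2" "b < 2"
      using K2 3 that by (auto simp: pay_def less_2_cases_iff)
    ultimately show ?thesis
      using 3 gain[of a] gain[of b] pay_bounds[of a 2 b] pay_bounds[of b 2 a] by (auto split: if_splits)
  next
    case 4
    have "pay a' p' (p + b div 2) = 0" "pay b'' p'' (p + a div 2) = 0" using 4 by (auto simp: pay_def)
    then show ?thesis
      using credit_gain[of p a] credit_gain[of p b] credit_le[OF 4]
        pay_bounds[of a p b] pay_bounds[of b p a] by linarith
  qed
qed

text \<open>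
  The potential \<open>\<Psi> t\<close> belongs to the boundary between the columns \<open>t\<close> and \<open>t + 1\<close>: credit of the
  supply that crosses it from the left, minus credit of the supply that crosses it from the right,
  corrected by the payments across it.
\<close>

lemma charge_telescope:
  fixes L R c :: "int \<Rightarrow> nat"
  assumes L: "\<And>t. L t = c t + L (t - 1) div 2" and R: "\<And>t. R t = c t + R (t + 1) div 2"
    and ends: "L (lo - 1) = 0" "R (hi + 1) = 0" and "lo \<le> hi"
    and K1: "\<And>t. t \<in> {lo..hi} \<Longrightarrow> L (t - 1) \<le> 1 \<Longrightarrow> R (t + 1) \<le> 1 \<Longrightarrow> 2 \<le> c t"
    and K2: "\<And>t. t \<in> {lo..hi} \<Longrightarrow> L (t - 1) = 0 \<Longrightarrow> R (t + 1) = 0 \<Longrightarrow> c t \<noteq> 2"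
    and K3: "\<And>t. L (t - 1) = 0 \<Longrightarrow> R (t + 2) = 0 \<Longrightarrow>
      \<not> (c t + c (t + 1) = 3 \<and> 1 \<le> c t \<and> 1 \<le> c (t + 1))"
  shows "credit (L hi) + credit (R lo) + 4 * nat (hi - lo + 1) \<le> 5 * (\<Sum>t\<in>{lo..hi}. c t)"
proof -
  define \<Psi> where "\<Psi> t = int (credit (L t)) - int (credit (R (t + 1)))
    - pay (L (t - 1)) (c t) (R (t + 1)) + pay (R (t + 2)) (c (t + 1)) (L t)" for t
  have step: "\<Psi> t - \<Psi> (t - 1) \<le> 5 * int (c t) - 4" if "t \<in> {lo..hi}" for t
  proof -
    have La: "L (t - 1) = c (t - 1) + L (t - 2) div 2" using L[of "t - 1"] by simp
    have Rb: "R (t + 1) = c (t + 1) + R (t + 2) div 2"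
      using R[of "t + 1"] by (simp add: add.commute)
    have K3': "\<not> (c (t - 1) = 2 \<and> c t = 1)" if "L (t - 2) = 0" "R (t + 1) = 0"
      using K3[of "t - 1"] that by (auto simp: add.commute)
    have K3'': "\<not> (c t = 1 \<and> c (t + 1) = 2)" if "L (t - 1) = 0" "R (t + 2) = 0"
      using K3[of t] that by auto
    have "\<Psi> (t - 1) = int (credit (L (t - 1))) - int (credit (R t))
      - pay (L (t - 2)) (c (t - 1)) (R t) + pay (R (t + 1)) (c t) (L (t - 1))"
      by (simp add: \<Psi>_def add.commute)
    moreover note column_balance[OF La Rb K1[OF that] K2[OF that] K3' K3'',
        folded L[of t] R[of t]]
    ultimately show ?thesis
      unfolding \<Psi>_def by linarith
  qed
  \<comment> \<open>Summation starts at the boundary before \<open>lo\<close>, where nothing arrives from the left.\<close>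
  have prefix: "\<Psi> (lo - 1 + int k) - \<Psi> (lo - 1) \<le> 5 * int (\<Sum>t\<in>{lo..lo - 1 + int k}. c t) - 4 * int k"
    if "lo - 1 + int k \<le> hi" for k
    using that
  proof (induction k)
    case (Suc k)
    have "{lo..lo - 1 + int (Suc k)} = insert (lo + int k) {lo..lo - 1 + int k}" by auto
    with Suc step[of "lo + int k"] show ?case by (simp add: algebra_simps)
  qed simp
  define N n where "N = (\<Sum>t\<in>{lo..hi}. c t)" and "n = nat (hi - lo + 1)"
  have "lo - 1 + int n = hi" using \<open>lo \<le> hi\<close> by (simp add: n_def)
  with prefix[of n] have "\<Psi> hi - \<Psi> (lo - 1) \<le> 5 * int N - 4 * int n"
    by (simp add: N_def)
  moreover have "\<Psi> hi = int (credit (L hi))"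
    using ends R[of "hi + 1"] by (auto simp: \<Psi>_def pay_def)
  moreover have "\<Psi> (lo - 1) = - int (credit (R lo))"
    using ends L[of "lo - 1"] by (auto simp: \<Psi>_def pay_def)
  ultimately show ?thesis unfolding N_def[symmetric] n_def[symmetric] by linarith
qed

section \<open>Local obstructions\<close>

text \<open>
  The variables stand for the pebbles on the two vertices of an even column (\<open>a\<close>, \<open>b\<close>) and the
  three of a neighbouring odd column (\<open>d\<close>, \<open>f\<close>, \<open>g\<close>), the inequalities for the weights seen
  from the five vertices. With three pebbles these weights exclude everything but two pebbles on a vertex of the
  even column and the third on the vertex of the odd column that is not adjacent to it.
\<close>

lemma pair_closeness:
  fixes a b d f g :: nat
  assumes "16 \<le> 16 * a + 4 * b + (8 * d + 8 * f + 2 * g)" "16 \<le> 4 * a + 16 * b + (2 * d + 8 * f + 8 * g)"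
    "16 \<le> 8 * a + 2 * b + (16 * d + 4 * f + g)" "16 \<le> 8 * a + 8 * b + (4 * d + 16 * f + 4 * g)"
    "16 \<le> 2 * a + 8 * b + (d + 4 * f + 16 * g)"
    and "a + b + (d + f + g) = 3" "1 \<le> a + b" "1 \<le> d + f + g"
  shows "a = 0 \<and> b = 2 \<and> d = 1 \<and> f = 0 \<and> g = 0 \<or> a = 2 \<and> b = 0 \<and> d = 0 \<and> f = 0 \<and> g = 1"
proof -
  have "a = 0 \<and> b = 1 \<or> a = 1 \<and> b = 0 \<or> a = 0 \<and> b = 2 \<or> a = 1 \<and> b = 1 \<or> a = 2 \<and> b = 0"
    using assms(6-8) by linarith
  moreover have "d = 0 \<or> d = 1 \<or> d = 2" "f = 0 \<or> f = 1 \<or> f = 2"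
    using assms(6-8) by linarith+
  moreover have "g = 3 - (a + b + d + f)" using assms(6) by linarith
  ultimately show ?thesis using assms by (elim disjE conjE) simp_all
qed

locale solvable_strip =
  fixes lo hi :: int and P :: "int \<times> int \<Rightarrow> nat"
  assumes lo_less_hi: "lo < hi"
    and dist: "pebbling_distribution (strip lo hi) P"
    and solv: "solvable (strip lo hi) P"
begin

abbreviation c where "c \<equiv> column_pebbles P"
abbreviation L where "L \<equiv> left_of lo P"
abbreviation R where "R \<equiv> right_of hi P"

lemma c_outside: "t \<notin> {lo..hi} \<Longrightarrow> c t = 0"
  using column_pebbles_outside[OF dist] .

lemma L_rec: "L t = c t + L (t - 1) div 2"
  by (rule left_supply_rec) (simp add: c_outside)

lemma R_rec: "R t = c t + R (t + 1) div 2"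
  by (rule right_supply_rec) (simp add: c_outside)

lemma empty_column: "c t = 0 \<Longrightarrow> (\<Sum>x\<in>cells t. f x * P x) = 0"
  by (simp add: column_pebbles_def)

text \<open>
  Such a column is a sealed window by itself if it holds at most one pebble, so its other vertices
  are never reached.
\<close>

lemma exposed_column_ge_2:
  assumes t: "t \<in> {lo..hi}" and "L (t - 1) \<le> 1" "R (t + 1) \<le> 1"
  shows "2 \<le> c t"
proof (rule ccontr)
  assume less: "\<not> 2 \<le> c t"
  have "sealed lo hi P t t"
    using assms less by (simp add: sealed_def capacity_def)
  from sealed_closeness[OF solv dist this _ _ t]
  have *: "16 \<le> (\<Sum>x\<in>cells t. closeness z x * P x)" if "z \<in> cells t" for z
    using that by simp
  show False
  proof (cases "even t")
    case True
    then obtain m where "t = 2 * m" by (elim evenE)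
    then show False
      using *[of "(m + 1, 1 - m)"] *[of "(m + 2, 2 - m)"] less
      by (simp add: cells_even closeness_def grid_dist_def column_pebbles_def)
  next
    case False
    then obtain m where "t = 2 * m + 1" by (elim oddE)
    then show False
      using *[of "(m + 1, - m)"] *[of "(m + 3, 2 - m)"] less
      by (simp add: cells_odd closeness_def grid_dist_def column_pebbles_def)
  qed
qed

text \<open>
  Three pebbles without help send at most one pebble to each neighbouring column, which then stays
  there. So the window of the three columns around \<open>t\<close> is sealed.
\<close>

lemma isolated_column_closeness:
  assumes t: "t \<in> {lo..hi}" and "L (t - 1) = 0" "R (t + 1) = 0" and "c t \<le> 3"
    and z: "z \<in> cells k" "k \<in> {t - 1..t + 1}" "k \<in> {lo..hi}"
  shows "16 \<le> (\<Sum>x\<in>cells t. closeness z x * P x)"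
proof -
  have e: "c (t - 1) = 0" "L (t - 2) \<le> 1" "c (t + 1) = 0" "R (t + 2) \<le> 1"
    using L_rec[of "t - 1"] R_rec[of "t + 1"] assms(2,3) by (auto simp: add.commute)
  have "sealed lo hi P (t - 1) (t + 1)"
    using assms(2-4) e L_rec[of t] R_rec[of t]
    by (simp add: sealed_def capacity_def add.commute)
  from sealed_closeness[OF solv dist this z]
  have "16 \<le> (\<Sum>i\<in>{t - 1..t + 1}. \<Sum>x\<in>cells i. closeness z x * P x)" .
  moreover have "{t - 1..t + 1} = {t - 1, t, t + 1}" by auto
  ultimately show ?thesis by (simp add: empty_column e)
qed

text \<open>
  An empty vertex of an odd column has distance at least two from all pebbles of the column, and
  three pebbles are too few for that. For an even column, the weights seen from the two
  outer vertices of a neighbouring column \<open>k\<close> add up to ten per pebble, so one of them is less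
  than sixteen. This is where the strip has to have more than one column.
\<close>

lemma isolated_column:
  assumes t: "t \<in> {lo..hi}" and iso: "L (t - 1) = 0" "R (t + 1) = 0" and le: "c t \<le> 3"
  shows "odd t \<and> (\<forall>v\<in>cells t. P v = 1)"
proof -
  obtain k where k: "k = t - 1 \<or> k = t + 1" "k \<in> {lo..hi}"
    using t lo_less_hi by (cases "t = lo") force+
  note * = isolated_column_closeness[OF t iso le]
  show ?thesis
  proof (cases "even t")
    case True
    then obtain m where m: "t = 2 * m" by (elim evenE)
    have in_k: "16 \<le> (\<Sum>x\<in>cells t. closeness z x * P x)" if "z \<in> cells k" for z
      using *[OF that] k by auto
    have "k = 2 * (m - 1) + 1 \<or> k = 2 * m + 1" using k m by auto
    then show ?thesis
    proof
      assume "k = 2 * (m - 1) + 1"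
      then show ?thesis
        using in_k[of "(m, 1 - m)"] in_k[of "(m + 2, 3 - m)"] le
        by (simp add: m cells_even cells_odd[of "m - 1", simplified] closeness_def grid_dist_def column_pebbles_def)
    next
      assume "k = 2 * m + 1"
      then show ?thesis
        using in_k[of "(m + 1, - m)"] in_k[of "(m + 3, 2 - m)"] le
        by (simp add: m cells_even cells_odd closeness_def grid_dist_def column_pebbles_def)
    qed
  next
    case False
    then obtain m where m: "t = 2 * m + 1" by (elim oddE)
    have in_t: "16 \<le> (\<Sum>x\<in>cells t. closeness z x * P x)" if "z \<in> cells t" for z
      using *[OF that] t by simp
    define a b d where "a = P (m + 1, - m)" and "b = P (m + 2, 1 - m)" and "d = P (m + 3, 2 - m)"
    have "16 \<le> 16 * a + 4 * b + d" "16 \<le> 4 * a + 16 * b + 4 * d" "16 \<le> a + 4 * b + 16 * d" "a + b + d \<le> 3"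
      using in_t[of "(m + 1, - m)"] in_t[of "(m + 2, 1 - m)"] in_t[of "(m + 3, 2 - m)"] le
      by (simp_all add: m cells_odd closeness_def grid_dist_def column_pebbles_def a_def b_def d_def)
    then have "1 \<le> a" "1 \<le> b" "1 \<le> d" "a + b + d \<le> 3" by linarith+
    then have "a = 1 \<and> b = 1 \<and> d = 1" by linarith
    then show ?thesis by (auto simp: m cells_odd a_def b_def d_def)
  qed
qed

lemma isolated_column_ge_3:
  assumes "t \<in> {lo..hi}" "L (t - 1) = 0" "R (t + 1) = 0"
  shows "3 \<le> c t"
proof (rule ccontr)
  assume "\<not> 3 \<le> c t"
  with isolated_column[OF assms] have "odd t" "\<forall>v\<in>cells t. P v = 1" by auto
  then have "c t = 3" by (auto elim!: oddE simp: column_pebbles_def cells_odd)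
  with \<open>\<not> 3 \<le> c t\<close> show False by simp
qed

text \<open>
  If \<open>u\<close> is the only vertex of the window with two pebbles and its neighbours are empty, then the
  first move from \<open>u\<close> leaves no vertex with two pebbles.
\<close>

lemma sealed_single_move:
  assumes sealed: "sealed lo hi P s e" and u: "P u = 2"
    and z: "z \<in> verts (strip lo hi)" "z \<in> (\<Union>i\<in>{s..e}. cells i)" "P z = 0" "grid_dist u z \<noteq> 1"
    and one: "\<And>x. x \<in> (\<Union>i\<in>{s..e}. cells i) \<Longrightarrow> x \<noteq> u \<Longrightarrow> P x \<le> 1"
    and none: "\<And>x. x \<in> (\<Union>i\<in>{s..e}. cells i) \<Longrightarrow> grid_dist u x = 1 \<Longrightarrow> P x = 0"
  shows False
proof -
  let ?W = "\<Union>i\<in>{s..e}. cells i"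
  obtain Q where Q: "(pebbling_move (strip lo hi))\<^sup>*\<^sup>* P Q" "1 \<le> Q z"
    using solv z(1) by (auto simp: solvable_def reachable_def)
  let ?moved = "\<lambda>Q. Q z = 0 \<and> (\<forall>x\<in>?W. Q x \<le> 1)"
  let ?I = "\<lambda>Q. sealed lo hi Q s e \<and> ((\<forall>x\<in>?W. Q x = P x) \<or> ?moved Q)"
  have "?I Q"
  proof (rule moves_invariant[OF Q(1) dist])
    fix Q x y
    assume dQ: "pebbling_distribution (strip lo hi) Q" and I: "?I Q"
      and xy: "adj (strip lo hi) x y" "2 \<le> Q x"
    let ?Q' = "Q(x := Q x - 2, y := Q y + 1)"
    note m = column_pebbles_move[of lo hi x y Q, OF xy]
    note move = sealed_move[OF dQ conjunct1[OF I] xy]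
    have V: "x \<in> verts (strip lo hi)" "y \<in> verts (strip lo hi)" "grid_dist x y = 1"
      using xy(1) by (auto simp: adj_strip grid_dist_def)
    have W: "v \<in> ?W \<longleftrightarrow> fst v - snd v \<in> {s..e}" if "v \<in> verts (strip lo hi)" for v
      using that unfolding mem_verts_strip cells_def by simp
    have same: "x \<in> ?W \<longleftrightarrow> y \<in> ?W"
      unfolding W[OF V(1)] W[OF V(2)] using move(1) m(1) by auto
    have "(\<forall>v\<in>?W. ?Q' v = P v) \<or> ?moved ?Q'"
    proof (cases "x \<in> ?W")
      case False
      define Q' where "Q' = ?Q'"
      have "Q' v = Q v" if "v \<in> ?W" for v
        using same False that by (auto simp: Q'_def)
      then have "(\<forall>v\<in>?W. Q' v = P v) \<or> ?moved Q'" using I z(2) by (metis (no_types, lifting))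
      then show ?thesis unfolding Q'_def .
    next
      case True
      then have P: "\<forall>v\<in>?W. Q v = P v" using I xy(2) by force
      then have "x = u" using one[OF True] xy(2) True by force
      then have "y \<noteq> z" "P y = 0" using V(3) z(4) none[of y] same True by auto
      moreover have "?Q' v \<le> 1" if "v \<in> ?W" for v
        using that P one[of v] u \<open>x = u\<close> \<open>P y = 0\<close> by auto
      ultimately show ?thesis using P z(2,3) xy(2) by auto
    qed
    with move(2) show "?I ?Q'" by blast
  qed (use sealed in simp)
  with Q(2) z(2,3) show False by auto
qed

text \<open>
  Weights rule out all positions of the three pebbles except those found in
  \<open>pair_closeness\<close>. There a single move exhausts all possibilities, and it does not
  reach the empty vertex of the even column.
\<close>

lemma isolated_pair:
  assumes iso: "L (t - 1) = 0" "R (t + 2) = 0"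
  shows "\<not> (c t + c (t + 1) = 3 \<and> 1 \<le> c t \<and> 1 \<le> c (t + 1))"
proof
  assume c: "c t + c (t + 1) = 3 \<and> 1 \<le> c t \<and> 1 \<le> c (t + 1)"
  then have t: "t \<in> {lo..hi}" "t + 1 \<in> {lo..hi}"
    using c_outside[of t] c_outside[of "t + 1"] by fastforce+
  have e: "c (t - 1) = 0" "L (t - 2) \<le> 1" "c (t + 2) = 0" "R (t + 3) \<le> 1"
    using L_rec[of "t - 1"] R_rec[of "t + 2"] iso by (auto simp: add.commute)
  have "L t = c t" "R (t + 1) = c (t + 1)"
    using L_rec[of t] R_rec[of "t + 1"] iso by (auto simp: add.commute)
  then have "L (t + 1) \<le> 2" "R t \<le> 2"
    using L_rec[of "t + 1"] R_rec[of t] c by auto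
  then have "L (1 + t) div 2 \<le> 1" "R t div 2 \<le> 1" by (simp_all add: add.commute)
  then have sealed: "sealed lo hi P (t - 1) (t + 2)"
    using e iso by (simp add: sealed_def capacity_def add.commute)
  have range: "{t - 1..t + 2} = {t - 1, t, t + 1, t + 2}" by auto
  have *: "16 \<le> (\<Sum>x\<in>cells t. closeness z x * P x) + (\<Sum>x\<in>cells (t + 1). closeness z x * P x)"
    if z: "z \<in> cells t \<or> z \<in> cells (t + 1)" for z
  proof -
    obtain k where "z \<in> cells k" "k \<in> {t - 1..t + 2}" "k \<in> {lo..hi}"
      using z t by fastforce
    from sealed_closeness[OF solv dist sealed this] show ?thesis
      unfolding range by (simp add: empty_column e)
  qed
  have zero: "P x = 0" if "x \<in> cells (t - 1) \<or> x \<in> cells (t + 2)" for x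
    using e that by (auto simp: column_pebbles_def)
  have window: "x \<in> (\<Union>i\<in>{t - 1..t + 2}. cells i) \<longleftrightarrow>
    x \<in> cells t \<union> cells (t + 1) \<or> x \<in> cells (t - 1) \<or> x \<in> cells (t + 2)" for x
    unfolding range by auto
  have lone_pair: False
    if u: "P u = 2" and z: "z \<in> cells t \<union> cells (t + 1)" "P z = 0" "grid_dist u z \<noteq> 1"
      and one: "\<And>x. x \<in> cells t \<union> cells (t + 1) \<Longrightarrow> x \<noteq> u \<Longrightarrow> P x \<le> 1"
      and none: "\<And>x. x \<in> cells t \<union> cells (t + 1) \<Longrightarrow> grid_dist u x = 1 \<Longrightarrow> P x = 0" for u z
  proof (rule sealed_single_move[OF sealed u, of z])
    show "z \<in> verts (strip lo hi)" using z(1) t by (auto simp: verts_strip)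
    show "z \<in> (\<Union>i\<in>{t - 1..t + 2}. cells i)" using z(1) unfolding window by blast
    show "P z = 0" "grid_dist u z \<noteq> 1" by fact+
    show "P x \<le> 1" if "x \<in> (\<Union>i\<in>{t - 1..t + 2}. cells i)" "x \<noteq> u" for x
      using that one[of x] zero[of x] unfolding window by fastforce
    show "P x = 0" if "x \<in> (\<Union>i\<in>{t - 1..t + 2}. cells i)" "grid_dist u x = 1" for x
      using that none[of x] zero[of x] unfolding window by blast
  qed
  show False
  proof (cases "even t")
    case True
    then obtain m where m: "t = 2 * m" by (elim evenE)
    have cells: "cells t = {(m + 1, 1 - m), (m + 2, 2 - m)}"
      "cells (t + 1) = {(m + 1, - m), (m + 2, 1 - m), (m + 3, 2 - m)}"
      unfolding m by (rule cells_even cells_odd)+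
    define a b d f g where "a = P (m + 1, 1 - m)" and "b = P (m + 2, 2 - m)"
      and "d = P (m + 1, - m)" and "f = P (m + 2, 1 - m)" and "g = P (m + 3, 2 - m)"
    note defs = a_def b_def d_def f_def g_def
    have "16 \<le> 16 * a + 4 * b + (8 * d + 8 * f + 2 * g)" "16 \<le> 4 * a + 16 * b + (2 * d + 8 * f + 8 * g)"
      "16 \<le> 8 * a + 2 * b + (16 * d + 4 * f + g)" "16 \<le> 8 * a + 8 * b + (4 * d + 16 * f + 4 * g)"
      "16 \<le> 2 * a + 8 * b + (d + 4 * f + 16 * g)"
      using *[of "(m + 1, 1 - m)"] *[of "(m + 2, 2 - m)"] *[of "(m + 1, - m)"]
        *[of "(m + 2, 1 - m)"] *[of "(m + 3, 2 - m)"]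
      by (simp_all add: cells closeness_def grid_dist_def defs)
    moreover have "a + b + (d + f + g) = 3" "1 \<le> a + b" "1 \<le> d + f + g"
      using c by (simp_all add: cells column_pebbles_def defs)
    ultimately have "a = 0 \<and> b = 2 \<and> d = 1 \<and> f = 0 \<and> g = 0 \<or> a = 2 \<and> b = 0 \<and> d = 0 \<and> f = 0 \<and> g = 1"
      by (rule pair_closeness)
    then show False
    proof
      assume "a = 0 \<and> b = 2 \<and> d = 1 \<and> f = 0 \<and> g = 0"
      then show False
        by (intro lone_pair[of "(m + 2, 2 - m)" "(m + 1, 1 - m)"]) (auto simp: cells grid_dist_def defs)
    next
      assume "a = 2 \<and> b = 0 \<and> d = 0 \<and> f = 0 \<and> g = 1"
      then show False
        by (intro lone_pair[of "(m + 1, 1 - m)" "(m + 2, 2 - m)"]) (auto simp: cells grid_dist_def defs)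
    qed
  next
    case False
    then obtain m where m: "t = 2 * m + 1" by (elim oddE)
    have t1: "t + 1 = 2 * (m + 1)" by (simp add: m)
    have cells: "cells t = {(m + 1, - m), (m + 2, 1 - m), (m + 3, 2 - m)}"
      "cells (t + 1) = {(m + 2, - m), (m + 3, 1 - m)}"
      unfolding t1 cells_even unfolding m cells_odd by (simp_all add: add.commute)
    define a b d f g where "a = P (m + 2, - m)" and "b = P (m + 3, 1 - m)"
      and "d = P (m + 1, - m)" and "f = P (m + 2, 1 - m)" and "g = P (m + 3, 2 - m)"
    note defs = a_def b_def d_def f_def g_def
    have "16 \<le> 16 * a + 4 * b + (8 * d + 8 * f + 2 * g)" "16 \<le> 4 * a + 16 * b + (2 * d + 8 * f + 8 * g)"
      "16 \<le> 8 * a + 2 * b + (16 * d + 4 * f + g)" "16 \<le> 8 * a + 8 * b + (4 * d + 16 * f + 4 * g)"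
      "16 \<le> 2 * a + 8 * b + (d + 4 * f + 16 * g)"
      using *[of "(m + 2, - m)"] *[of "(m + 3, 1 - m)"] *[of "(m + 1, - m)"]
        *[of "(m + 2, 1 - m)"] *[of "(m + 3, 2 - m)"]
      by (simp_all add: cells closeness_def grid_dist_def defs)
    moreover have "a + b + (d + f + g) = 3" "1 \<le> a + b" "1 \<le> d + f + g"
      using c by (simp_all add: cells column_pebbles_def defs)
    ultimately have "a = 0 \<and> b = 2 \<and> d = 1 \<and> f = 0 \<and> g = 0 \<or> a = 2 \<and> b = 0 \<and> d = 0 \<and> f = 0 \<and> g = 1"
      by (rule pair_closeness)
    then show False
    proof
      assume "a = 0 \<and> b = 2 \<and> d = 1 \<and> f = 0 \<and> g = 0"
      then show False
        by (intro lone_pair[of "(m + 3, 1 - m)" "(m + 2, - m)"]) (auto simp: cells grid_dist_def defs)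
    next
      assume "a = 2 \<and> b = 0 \<and> d = 0 \<and> f = 0 \<and> g = 1"
      then show False
        by (intro lone_pair[of "(m + 2, - m)" "(m + 3, 1 - m)"]) (auto simp: cells grid_dist_def defs)
    qed
  qed
qed

lemma size_eq_columns: "distribution_size (strip lo hi) P = (\<Sum>t\<in>{lo..hi}. c t)"
  unfolding distribution_size_def verts_strip column_pebbles_def
  by (rule sum.UNION_disjoint) (simp, simp, auto simp: cells_def)

theorem charge_bound:
  "credit (L hi) + credit (R lo) + 4 * nat (hi - lo + 1) \<le> 5 * distribution_size (strip lo hi) P"
proof -
  have "credit (L hi) + credit (R lo) + 4 * nat (hi - lo + 1) \<le> 5 * (\<Sum>t\<in>{lo..hi}. c t)"
  proof (rule charge_telescope)
    show "L t = c t + L (t - 1) div 2" "R t = c t + R (t + 1) div 2" for t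
      by (rule L_rec R_rec)+
    show "L (lo - 1) = 0" "R (hi + 1) = 0"
      by (simp_all add: left_supply_outside right_supply_outside)
    show "lo \<le> hi" using lo_less_hi by simp
    show "2 \<le> c t" if "t \<in> {lo..hi}" "L (t - 1) \<le> 1" "R (t + 1) \<le> 1" for t
      using exposed_column_ge_2[OF that] .
    show "c t \<noteq> 2" if "t \<in> {lo..hi}" "L (t - 1) = 0" "R (t + 1) = 0" for t
      using isolated_column_ge_3[OF that] by simp
    show "\<not> (c t + c (t + 1) = 3 \<and> 1 \<le> c t \<and> 1 \<le> c (t + 1))"
      if "L (t - 1) = 0" "R (t + 2) = 0" for t
      using isolated_pair[OF that] .
  qed
  then show ?thesis by (simp add: size_eq_columns)
qed

text \<open>
  Let \<open>e\<close> be an empty end column with three vertices whose only neighbouring column \<open>e'\<close> holds some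
  pebble, on \<open>x\<close> say. The outer vertex \<open>z\<close> of \<open>e\<close> that is not adjacent to \<open>x\<close> needs two pebbles on the other
  vertex of \<open>e'\<close>. With capacity two this is impossible while \<open>x\<close> is occupied, and after the first
  move out of \<open>e'\<close> the capacity is at most one.
\<close>

lemma end_column_served:
  assumes e: "odd e" "e \<in> {lo..hi}" "e' \<in> {lo..hi}" "\<bar>e - e'\<bar> = 1"
    and nb: "\<And>t. t \<in> {lo..hi} \<Longrightarrow> \<bar>e - t\<bar> = 1 \<Longrightarrow> t = e'"
    and c: "c e = 0" "1 \<le> c e'" "capacity_of lo hi P e' \<le> 2"
  shows False
proof -
  have "even e'" using e(1,4) by presburger
  then obtain m where m: "e' = 2 * m" by (elim evenE)
  have "\<exists>x z. x \<in> cells e' \<and> z \<in> cells e \<and> grid_dist x z \<noteq> 1 \<and> 1 \<le> P x"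
  proof -
    have "1 \<le> P (m + 1, 1 - m) \<or> 1 \<le> P (m + 2, 2 - m)"
      using c(2) by (auto simp: column_pebbles_def m cells_even)
    moreover have "e = 2 * (m - 1) + 1 \<or> e = 2 * m + 1" using e(4) m by auto
    ultimately consider "1 \<le> P (m + 1, 1 - m)" "e = 2 * (m - 1) + 1" | "1 \<le> P (m + 1, 1 - m)" "e = 2 * m + 1"
      | "1 \<le> P (m + 2, 2 - m)" "e = 2 * (m - 1) + 1" | "1 \<le> P (m + 2, 2 - m)" "e = 2 * m + 1"
      by blast
    then show ?thesis
    proof cases
      case 1
      then show ?thesis
        by (intro exI[of _ "(m + 1, 1 - m)"] exI[of _ "(m + 2, 3 - m)"])
          (simp add: m cells_def grid_dist_def)
    next
      case 2
      then show ?thesis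
        by (intro exI[of _ "(m + 1, 1 - m)"] exI[of _ "(m + 3, 2 - m)"])
          (simp add: m cells_def grid_dist_def)
    next
      case 3
      then show ?thesis
        by (intro exI[of _ "(m + 2, 2 - m)"] exI[of _ "(m, 1 - m)"])
          (simp add: m cells_def grid_dist_def)
    next
      case 4
      then show ?thesis
        by (intro exI[of _ "(m + 2, 2 - m)"] exI[of _ "(m + 1, - m)"])
          (simp add: m cells_def grid_dist_def)
    qed
  qed
  then obtain x z where xz: "x \<in> cells e'" "z \<in> cells e" "grid_dist x z \<noteq> 1" "1 \<le> P x" by blast
  have "z \<in> verts (strip lo hi)" using xz e(2) by (auto simp: verts_strip)
  then obtain Q where Q: "(pebbling_move (strip lo hi))\<^sup>*\<^sup>* P Q" "1 \<le> Q z"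
    using solv by (auto simp: solvable_def reachable_def)
  \<comment> \<open>The first alternative describes the time before any move out of \<open>e'\<close>.\<close>
  let ?I = "\<lambda>Q. Q z = 0 \<and> capacity_of lo hi Q e' \<le> 2 \<and>
    (column_pebbles Q e = 0 \<and> 1 \<le> Q x \<or> capacity_of lo hi Q e' \<le> 1)"
  have "?I Q"
  proof (rule moves_invariant[OF Q(1) dist])
    have "P z = 0" using c(1) xz(2) by (simp add: column_pebbles_def)
    with c xz(4) show "?I P" by simp
  next
    fix Q u v
    assume dQ: "pebbling_distribution (strip lo hi) Q" and I: "?I Q"
      and uv: "adj (strip lo hi) u v" "2 \<le> Q u"
    let ?Q' = "Q(u := Q u - 2, v := Q v + 1)" and ?k = "fst u - snd u" and ?k' = "fst v - snd v"
    note m = column_pebbles_move[of lo hi u v Q, OF uv]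
    have T: "capacity_of lo hi ?Q' e' + (if e' = ?k then 1 else 0) \<le> capacity_of lo hi Q e'"
      by (rule capacity_move[OF _ m(4,1,3,5)]) (rule column_pebbles_outside[OF dQ])
    have le_T: "column_pebbles Q e' \<le> capacity_of lo hi Q e'" by (simp add: capacity_def)
    have uv': "u \<in> verts (strip lo hi)" "v \<in> verts (strip lo hi)" "grid_dist u v = 1"
      using uv(1) by (auto simp: adj_strip grid_dist_def)
    have col: "?k = e'" if "?k' = e"
      using nb[OF m(2)] m(1) that by auto
    have in_e': "u \<in> cells e'" if "?k = e'"
      using that uv'(1) by (auto simp: mem_verts_strip cells_def)
    have "v \<noteq> z"
    proof
      assume "v = z"
      then have u: "u \<in> cells e'" "u \<noteq> x" using col in_e' xz(2,3) uv'(3) by (auto simp: cells_def)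
      have "Q u + Q x \<le> column_pebbles Q e'"
        using sum_mono2[of "cells e'" "{u, x}" Q] u xz(1) by (simp add: column_pebbles_def)
      then show False using I uv(2) le_T by auto
    qed
    moreover have "Q z = 0" using I by simp
    ultimately have "?Q' z = 0" using uv(2) by auto
    moreover have "capacity_of lo hi ?Q' e' \<le> 2" using T I by linarith
    moreover have "column_pebbles ?Q' e = 0 \<and> 1 \<le> ?Q' x \<or> capacity_of lo hi ?Q' e' \<le> 1"
    proof (cases "?k = e' \<or> capacity_of lo hi Q e' \<le> 1")
      case True
      then show ?thesis using T I by (auto split: if_splits)
    next
      case False
      then have "column_pebbles Q e = 0" "1 \<le> Q x" using I by auto
      moreover have "?k \<noteq> e" using m(4) calculation(1) by auto
      moreover have "?k' \<noteq> e" using col False by blast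
      moreover have "u \<noteq> x" using False xz(1) by (auto simp: cells_def)
      ultimately show ?thesis by (subst m(5)) auto
    qed
    ultimately show "?I ?Q'" by blast
  qed
  with Q(2) show False by simp
qed

text \<open>
  A nonempty end column would be a single pebble without a supply of two, contrary to
  \<open>exposed_column_ge_2\<close>.
\<close>

lemma end_column_empty:
  shows "R lo \<le> 1 \<Longrightarrow> c lo = 0 \<and> 2 \<le> R (lo + 1)" "L hi \<le> 1 \<Longrightarrow> c hi = 0 \<and> 2 \<le> L (hi - 1)"
proof -
  show "c lo = 0 \<and> 2 \<le> R (lo + 1)" if "R lo \<le> 1"
    using exposed_column_ge_2[of lo] lo_less_hi that R_rec[of lo]
    by (cases "R (lo + 1) \<le> 1") (auto simp: left_supply_outside)
  show "c hi = 0 \<and> 2 \<le> L (hi - 1)" if "L hi \<le> 1"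
    using exposed_column_ge_2[of hi] lo_less_hi that L_rec[of hi]
    by (cases "L (hi - 1) \<le> 1") (auto simp: right_supply_outside)
qed

text \<open>
  With three pebbles the credit left at the ends is at most 3, hence 0. So the end columns are empty, and
  the isolated middle column has a single pebble on each vertex. Then no move is possible.
\<close>

lemma three_columns:
  assumes hi: "hi = lo + 2"
  shows "4 \<le> distribution_size (strip lo hi) P"
proof (rule ccontr)
  assume less: "\<not> 4 \<le> distribution_size (strip lo hi) P"
  with charge_bound hi have size: "distribution_size (strip lo hi) P = 3" and
    "credit (L hi) < 4" "credit (R lo) < 4" by auto
  then have ends: "c lo = 0" "c hi = 0"
    using end_column_empty by (auto dest!: credit_less_4)
  have "{lo..hi} = {lo, lo + 1, hi}" using hi by auto
  with size have "(\<Sum>t\<in>{lo, lo + 1, hi}. c t) = 3" by (simp add: size_eq_columns)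
  with ends hi have c: "c (lo + 1) = 3" by simp
  have "L lo = 0" "R (lo + 2) = 0"
    using ends hi L_rec[of lo] R_rec[of hi] by (simp_all add: left_supply_outside right_supply_outside)
  with isolated_column[of "lo + 1"] c hi have one: "odd (lo + 1)" "\<forall>v\<in>cells (lo + 1). P v = 1"
    by (auto simp: add.commute)
  have zero: "P v = 0" if "v \<in> cells lo \<or> v \<in> cells hi" for v
    using ends that by (auto simp: column_pebbles_def)
  have small: "P v \<le> 1" for v
  proof (cases "v \<in> verts (strip lo hi)")
    case True
    then have "v \<in> cells lo \<or> v \<in> cells (lo + 1) \<or> v \<in> cells hi"
      using \<open>{lo..hi} = _\<close> by (auto simp: verts_strip)
    then show ?thesis using one zero[of v] by auto
  next
    case False
    then have "P v = 0" using dist unfolding pebbling_distribution_def by blast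
    then show ?thesis by simp
  qed
  from one(1) obtain m where "lo = 2 * m" by (auto elim: evenE)
  then have "cells lo \<noteq> {}" by (simp add: cells_even)
  then obtain z where z: "z \<in> cells lo" by blast
  then have "z \<in> verts (strip lo hi)" using hi by (auto simp: verts_strip)
  then obtain Q where Q: "(pebbling_move (strip lo hi))\<^sup>*\<^sup>* P Q" "1 \<le> Q z"
    using solv by (auto simp: solvable_def reachable_def)
  have "Q = P"
  proof (rule moves_invariant[OF Q(1) dist])
    fix Q u v
    assume "Q = P" "2 \<le> Q u"
    then have False using small[of u] by simp
    then show "Q(u := Q u - 2, v := Q v + 1) = P" ..
  qed simp
  with Q(2) zero z show False by auto
qed

text \<open>
  With six pebbles at most two units of credit are left, hence none, and both end columns are empty.
  By \<open>end_column_served\<close> each of them needs a supply of three, or one of at least two that comes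
  entirely from further inside. The linear bounds on the supplies leave only the distribution
  \<open>0, 3, 0, 0, 0, 3, 0\<close>, which does not serve the middle column.
\<close>

lemma seven_columns:
  assumes hi: "hi = lo + 6" and odd: "odd lo"
  shows "7 \<le> distribution_size (strip lo hi) P"
proof (rule ccontr)
  assume less: "\<not> 7 \<le> distribution_size (strip lo hi) P"
  with charge_bound hi have size: "distribution_size (strip lo hi) P = 6" and
    "credit (L hi) < 4" "credit (R lo) < 4" by auto
  then have le1: "L hi \<le> 1" "R lo \<le> 1" by (auto dest!: credit_less_4)
  from end_column_empty(1)[OF le1(2)] end_column_empty(2)[OF le1(1)]
  have e: "c lo = 0" "2 \<le> R (lo + 1)" "c (lo + 6) = 0" "2 \<le> L (lo + 5)"
    by (simp_all add: hi add.commute)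
  have L0: "L lo = 0" and R0: "R (lo + 6) = 0"
    using e L_rec[of lo] R_rec[of hi] by (simp_all add: hi left_supply_outside right_supply_outside)
  have Lk: "L (lo + k) = c (lo + k) + L (lo + (k - 1)) div 2"
    and Rk: "R (lo + k) = c (lo + k) + R (lo + (k + 1)) div 2" for k
    using L_rec[of "lo + k"] R_rec[of "lo + k"] by (simp_all only: add_diff_eq add.assoc)
  have Ls: "L (lo + 1) = c (lo + 1)" "L (lo + 2) = c (lo + 2) + L (lo + 1) div 2"
    "L (lo + 3) = c (lo + 3) + L (lo + 2) div 2" "L (lo + 4) = c (lo + 4) + L (lo + 3) div 2"
    "L (lo + 5) = c (lo + 5) + L (lo + 4) div 2"
    using Lk[of 1] Lk[of 2] Lk[of 3] Lk[of 4] Lk[of 5] L0 by simp_all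
  have Rs: "R (lo + 5) = c (lo + 5)" "R (lo + 4) = c (lo + 4) + R (lo + 5) div 2"
    "R (lo + 3) = c (lo + 3) + R (lo + 4) div 2" "R (lo + 2) = c (lo + 2) + R (lo + 3) div 2"
    "R (lo + 1) = c (lo + 1) + R (lo + 2) div 2"
    using Rk[of 1] Rk[of 2] Rk[of 3] Rk[of 4] Rk[of 5] R0 by simp_all
  have left: "c (lo + 1) = 0 \<or> 3 \<le> R (lo + 1)"
  proof (rule ccontr)
    assume "\<not> ?thesis"
    then show False
      using odd e L0 Rs(5) by (intro end_column_served[of lo "lo + 1"]) (auto simp: hi capacity_def add.commute[of 2])
  qed
  have right: "c (lo + 5) = 0 \<or> 3 \<le> L (lo + 5)"
  proof (rule ccontr)
    assume "\<not> ?thesis"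
    then show False
      using odd e R0 Ls(5) by (intro end_column_served[of "lo + 6" "lo + 5"]) (auto simp: hi capacity_def add.commute[of 4] add.commute[of 6])
  qed
  have middle: "2 \<le> L (lo + 2) \<or> 2 \<le> R (lo + 4) \<or> 2 \<le> c (lo + 3)"
  proof (rule ccontr)
    assume not: "\<not> ?thesis"
    then have "2 \<le> c (lo + 3)"
      by (intro exposed_column_ge_2) (auto simp: hi add.commute[of 2] add.commute[of 4])
    with not show False by simp
  qed
  have "{lo..hi} = {lo, lo + 1, lo + 2, lo + 3, lo + 4, lo + 5, lo + 6}" using hi by auto
  with size e have sum: "c (lo + 1) + c (lo + 2) + c (lo + 3) + c (lo + 4) + c (lo + 5) = 6"
    by (simp add: size_eq_columns)
  have half: "a = b + n div 2 \<Longrightarrow> 2 * a \<le> 2 * b + n" for a b n :: nat by simp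
  have L_le: "8 * L (lo + 4) \<le> 8 * c (lo + 4) + 4 * c (lo + 3) + 2 * c (lo + 2) + c (lo + 1)"
    using half[OF Ls(2)] half[OF Ls(3)] half[OF Ls(4)] Ls(1) by linarith
  have R_le: "8 * R (lo + 2) \<le> 8 * c (lo + 2) + 4 * c (lo + 3) + 2 * c (lo + 4) + c (lo + 5)"
    using half[OF Rs(2)] half[OF Rs(3)] half[OF Rs(4)] Rs(1) by linarith
  have left': "4 \<le> R (lo + 2) \<and> c (lo + 1) = 0 \<or> 6 \<le> 2 * c (lo + 1) + R (lo + 2)"
    using left e(2) Rs(5) half[OF Rs(5)] by (cases "c (lo + 1) = 0") auto
  have right': "4 \<le> L (lo + 4) \<and> c (lo + 5) = 0 \<or> 6 \<le> 2 * c (lo + 5) + L (lo + 4)"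
    using right e(4) Ls(5) half[OF Ls(5)] by (cases "c (lo + 5) = 0") auto
  have "c (lo + 2) = 0" "c (lo + 3) = 0" "c (lo + 4) = 0" "c (lo + 1) = 3" "c (lo + 5) = 3"
    using left' right' sum L_le R_le by (elim disjE; linarith)+
  with middle Ls Rs show False by simp
qed

end

lemma optimal_solvable_strip:
  assumes "lo < hi"
  obtains P where "solvable_strip lo hi P"
    "distribution_size (strip lo hi) P = optimal_pebbling_number (strip lo hi)"
  using optimal_pebbling_number_attained[of "strip lo hi"] assms
  by (auto simp: solvable_strip_def)

lemma optimal_strip:
  fixes lo :: int
  assumes "r \<in> {0, 1, 2, 3, 4}" "5 * k + r \<ge> 1" "5 * k + r \<notin> {1, 2, 3, 7}"
  shows "optimal_pebbling_number (strip lo (lo + int (5 * k + r) - 1)) = 4 * k + r"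
proof (rule antisym)
  let ?hi = "lo + int (5 * k + r) - 1"
  show "optimal_pebbling_number (strip lo ?hi) \<le> 4 * k + r"
    using solvable_with_4k_plus_r[OF assms] by (rule optimal_le)
  have "2 \<le> 5 * k + r" using assms(2,3) by auto
  then have "lo < ?hi" by simp
  then obtain P where P: "solvable_strip lo ?hi P"
    "distribution_size (strip lo ?hi) P = optimal_pebbling_number (strip lo ?hi)"
    by (rule optimal_solvable_strip)
  have n: "nat (?hi - lo + 1) = 5 * k + r" by simp
  have "4 * (5 * k + r) \<le> 5 * optimal_pebbling_number (strip lo ?hi)"
    using solvable_strip.charge_bound[OF P(1), unfolded n P(2)] by (rule add_leD2)
  moreover have "4 * k + r \<le> s" if "4 * (5 * k + r) \<le> 5 * s" for s
    using that assms(1) by auto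
  ultimately show "4 * k + r \<le> optimal_pebbling_number (strip lo ?hi)" by blast
qed

lemma optimal_strip_3: "optimal_pebbling_number (strip lo (lo + 2)) = 4"
proof (rule antisym)
  show "optimal_pebbling_number (strip lo (lo + 2)) \<le> 4"
    by (intro optimal_le solvable_with_block[of _ "lo + 1"]) auto
  have "lo < lo + 2" by simp
  then obtain P where P: "solvable_strip lo (lo + 2) P"
    "distribution_size (strip lo (lo + 2)) P = optimal_pebbling_number (strip lo (lo + 2))"
    by (rule optimal_solvable_strip)
  have "4 \<le> distribution_size (strip lo (lo + 2)) P"
    by (rule solvable_strip.three_columns[OF P(1)]) simp
  then show "4 \<le> optimal_pebbling_number (strip lo (lo + 2))" by (simp only: P(2))
qed

lemma optimal_strip_7: "optimal_pebbling_number (strip 1 7) = 7"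
proof (rule antisym)
  show "optimal_pebbling_number (strip 1 7) \<le> 7"
    using solvable_with_7_8_odd[of 7 1] by (intro optimal_le) simp
  have "(1 :: int) < 7" by simp
  then obtain P where P: "solvable_strip 1 7 P"
    "distribution_size (strip 1 7) P = optimal_pebbling_number (strip 1 7)"
    by (rule optimal_solvable_strip)
  have "7 \<le> distribution_size (strip 1 7) P"
    by (rule solvable_strip.seven_columns[OF P(1)]) simp_all
  then show "7 \<le> optimal_pebbling_number (strip 1 7)" by (simp only: P(2))
qed

theorem theorem2p8:
  shows "(\<forall>k r :: nat. r \<in> {0, 1, 2, 3, 4} \<longrightarrow> 5 * k + r \<ge> 1 \<longrightarrow> 5 * k + r \<notin> {1, 2, 3, 7} \<longrightarrow>
            optimal_pebbling_number (S_graph 5 (5 * k + r)) = 4 * k + r \<and>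
            optimal_pebbling_number (S_graph' 5 (5 * k + r)) = 4 * k + r) \<and>
         optimal_pebbling_number (S_graph 5 3) = 4 \<and>
         optimal_pebbling_number (S_graph' 5 3) = 4 \<and>
         optimal_pebbling_number (S_graph' 5 7) = 7"
proof (intro conjI allI impI)
  fix k r :: nat
  assume r: "r \<in> {0, 1, 2, 3, 4}" "5 * k + r \<ge> 1" "5 * k + r \<notin> {1, 2, 3, 7}"
  show "optimal_pebbling_number (S_graph 5 (5 * k + r)) = 4 * k + r"
    using optimal_strip[OF r, of 0] by (simp add: S_graph_eq_strip)
  show "optimal_pebbling_number (S_graph' 5 (5 * k + r)) = 4 * k + r"
    using optimal_strip[OF r, of 1] by (simp add: S_graph'_eq_strip)
qed (use optimal_strip_3[of 0] optimal_strip_3[of 1] optimal_strip_7 in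
    \<open>simp_all add: S_graph_eq_strip S_graph'_eq_strip\<close>)

end
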